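(* For all integers $g\geq 1$ and $\ell\geq 1$, the pair $(g\mathrm{exc}_\ell, g\mathrm{den}_\ell)$ is $r$-Euler-Mahonian with $r=g+\ell-1$; that is, for every $n\geq 1$, $$\sum_{\pi\in\mathfrak{S}_n} t^{g\mathrm{exc}_\ell(\pi)}q^{g\mathrm{den}_\ell(\pi)}=\sum_{\pi\in\mathfrak{S}_n} t^{r\mathrm{des}(\pi)}q^{r\mathrm{maj}(\pi)},\qquad r=g+\ell-1.$$
   Context: Let $[n]=\{1,\dots,n\}$ and let $\mathfrak{S}_n$ be the set of permutations $\pi=\pi_1\pi_2\cdots\pi_n$ of $[n]$ in one-line notation. For a word $w=w_1\cdots w_k$ of distinct integers, $\mathrm{inv}(w)$ is the number of pairs $i<j$ with $w_i>w_j$. For $r\geq 1$ and $\pi\in\mathfrak{S}_n$, let $r\mathrm{Des}(\pi)=\{i\in[n-1]\mid \pi_i\geq \pi_{i+1}+r\}$ and $r\mathrm{Inv}(\pi)=\{(i,j)\mid i<j,\ \pi_i>\pi_j,\ \pi_i<\pi_j+r\}$. Set $r\mathrm{des}(\pi)=|r\mathrm{Des}(\pi)|$ and $r\mathrm{maj}(\pi)=\sum_{i\in r\mathrm{Des}(\pi)} i+|r\mathrm{Inv}(\pi)|$. For $g,\ell\geq 1$ and $\pi\in\mathfrak{S}_n$, an index $i\in[n-1]$ is a $g$-gap $\ell$-level excedance place if $\pi_i\geq i+g$ and $\pi_i\geq \ell$. Let $g\mathrm{Excp}_\ell(\pi)$ be the set of these places and $g\mathrm{Nexcp}_\ell(\pi)=[n]\setminus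 g\mathrm{Excp}_\ell(\pi)$. Let $g\mathrm{Exc}_\ell(\pi)$ (resp. $g\mathrm{Nexc}_\ell(\pi)$) be the subword of $\pi$ formed by the letters $\pi_i$ with $i\in g\mathrm{Excp}_\ell(\pi)$ (resp. $i\in g\mathrm{Nexcp}_\ell(\pi)$), in increasing order of $i$. Define $$g\mathrm{den}_\ell(\pi)=\sum_{i\in g\mathrm{Excp}_\ell(\pi)}(i+g-1)+\mathrm{inv}(g\mathrm{Exc}_\ell(\pi))+\mathrm{inv}(g\mathrm{Nexc}_\ell(\pi)),$$ $$g\mathrm{exc}_\ell(\pi)=|\{i\mid \pi_i\geq i+g,\ i\geq \ell\}|.$$ *)

theory Defs
  imports
    "HOL-Combinatorics.Permutations"
    "HOL-Computational_Algebra.Polynomial"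
begin

text \<open>
  A permutation of \<open>[n]\<close> is a function \<open>\<pi> :: nat \<Rightarrow> nat\<close> with \<open>\<pi> permutes {1..n}\<close>; its one-line
  notation is \<open>\<pi> 1 \<dots> \<pi> n\<close>. Since such a function does not determine \<open>n\<close>, every statistic takes
  \<open>n\<close> as an explicit argument.
\<close>

definition Sym :: "nat \<Rightarrow> (nat \<Rightarrow> nat) set" where
  "Sym n = {\<pi>. \<pi> permutes {1..n}}"

definition word_inv :: "nat list \<Rightarrow> nat" where
  "word_inv w = card {(i, j). i < j \<and> j < length w \<and> w ! i > w ! j}"

definition subword :: "(nat \<Rightarrow> nat) \<Rightarrow> nat set \<Rightarrow> nat list" where
  "subword \<pi> S = map \<pi> (sorted_list_of_set S)"

definition rDes :: "nat \<Rightarrow> nat \<Rightarrow> (nat \<Rightarrow> nat) \<Rightarrow> nat set" where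
  "rDes r n \<pi> = {i \<in> {1..n - 1}. \<pi> i \<ge> \<pi> (i + 1) + r}"

definition rInv :: "nat \<Rightarrow> nat \<Rightarrow> (nat \<Rightarrow> nat) \<Rightarrow> (nat \<times> nat) set" where
  "rInv r n \<pi> = {(i, j). i \<in> {1..n} \<and> j \<in> {1..n} \<and> i < j \<and> \<pi> i > \<pi> j \<and> \<pi> i < \<pi> j + r}"

definition rdes :: "nat \<Rightarrow> nat \<Rightarrow> (nat \<Rightarrow> nat) \<Rightarrow> nat" where
  "rdes r n \<pi> = card (rDes r n \<pi>)"

definition rmaj :: "nat \<Rightarrow> nat \<Rightarrow> (nat \<Rightarrow> nat) \<Rightarrow> nat" where
  "rmaj r n \<pi> = (\<Sum>i\<in>rDes r n \<pi>. i) + card (rInv r n \<pi>)"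

definition gExcp :: "nat \<Rightarrow> nat \<Rightarrow> nat \<Rightarrow> (nat \<Rightarrow> nat) \<Rightarrow> nat set" where
  "gExcp g l n \<pi> = {i \<in> {1..n - 1}. \<pi> i \<ge> i + g \<and> \<pi> i \<ge> l}"

definition gNexcp :: "nat \<Rightarrow> nat \<Rightarrow> nat \<Rightarrow> (nat \<Rightarrow> nat) \<Rightarrow> nat set" where
  "gNexcp g l n \<pi> = {1..n} - gExcp g l n \<pi>"

definition gExc :: "nat \<Rightarrow> nat \<Rightarrow> nat \<Rightarrow> (nat \<Rightarrow> nat) \<Rightarrow> nat list" where
  "gExc g l n \<pi> = subword \<pi> (gExcp g l n \<pi>)"

definition gNexc :: "nat \<Rightarrow> nat \<Rightarrow> nat \<Rightarrow> (nat \<Rightarrow> nat) \<Rightarrow> nat list" where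
  "gNexc g l n \<pi> = subword \<pi> (gNexcp g l n \<pi>)"

definition gden :: "nat \<Rightarrow> nat \<Rightarrow> nat \<Rightarrow> (nat \<Rightarrow> nat) \<Rightarrow> nat" where
  "gden g l n \<pi> =
     (\<Sum>i\<in>gExcp g l n \<pi>. i + g - 1) + word_inv (gExc g l n \<pi>) + word_inv (gNexc g l n \<pi>)"

text \<open>Here the level condition is on the place \<open>i\<close>, whereas in \<open>gExcp\<close> it is on the letter \<open>\<pi> i\<close>.\<close>

definition gexc :: "nat \<Rightarrow> nat \<Rightarrow> nat \<Rightarrow> (nat \<Rightarrow> nat) \<Rightarrow> nat" where
  "gexc g l n \<pi> = card {i \<in> {1..n}. \<pi> i \<ge> i + g \<and> i \<ge> l}"

text \<open>
  Generating functions live in \<open>\<int>[q][t]\<close>: \<open>t\<close> is the outer variable, \<open>q\<close> the inner one.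
\<close>

definition var_t :: "int poly poly" where
  "var_t = [:0, 1:]"

definition var_q :: "int poly poly" where
  "var_q = [:[:0, 1:]:]"

definition r_Euler_Mahonian ::
    "nat \<Rightarrow> (nat \<Rightarrow> (nat \<Rightarrow> nat) \<Rightarrow> nat) \<Rightarrow> (nat \<Rightarrow> (nat \<Rightarrow> nat) \<Rightarrow> nat) \<Rightarrow> bool" where
  "r_Euler_Mahonian r st1 st2 \<longleftrightarrow>
     (\<forall>n\<ge>1. (\<Sum>\<pi>\<in>Sym n. var_t ^ st1 n \<pi> * var_q ^ st2 n \<pi>) =
            (\<Sum>\<pi>\<in>Sym n. var_t ^ rdes r n \<pi> * var_q ^ rmaj r n \<pi>))"

end

theory Submission
  imports Defs
begin

text \<open>
  Build a permutation by scanning places and letters in increasing order, a letter \<open>z\<close> coming before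
  a place \<open>x\<close> iff \<open>z < max (x + g) l\<close>. A place either takes an unused letter that has already
  arrived, or stays open and becomes an excedance when a later letter fills it. Each choice adds to
  Denert's statistic its rank among the possible choices, so the generating function is a matrix
  element of a product of operators on functions of the number of open places: a place
  \<open>x\<close> acts as \<open>P(v) = raising\<close>, where an excedance has weight \<open>v = q ^ (x + g - 1)\<close>, times \<open>t\<close> if \<open>x \<ge> l\<close>,
  and a letter acts as \<open>L = lowering\<close>. The operator \<open>W(v) = intertwiner\<close> satisfies
  \<open>L P(q v) W(v) = W(q v) L P(v)\<close>; moving it through the product \<open>D n t\<close> yields
  \<open>(1 - q) D (n+1) t = (1 - t q ^ (n+1)) D n t - q ^ r (1 - t) D n (q t)\<close> for \<open>n \<ge> r\<close>, and
  \<open>D (n+1) = [n+1] D n\<close> for \<open>n < r\<close>. Rawlings' insertion of the largest letter shows the same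
  recurrence for \<open>(rdes, rmaj)\<close>.
\<close>

subsection \<open>Transfer operators\<close>

definition qnum :: "'a::comm_ring_1 \<Rightarrow> nat \<Rightarrow> 'a" where
  "qnum q n = (\<Sum>i<n. q ^ i)"

lemma qnum_0 [simp]: "qnum q 0 = 0" and qnum_Suc: "qnum q (Suc n) = qnum q n + q ^ n"
  by (simp_all add: qnum_def)

lemma one_minus_times_qnum: "(1 - q) * qnum q n = 1 - q ^ n"
  by (simp add: qnum_def one_diff_power_eq)

lemma power_eq_qnum: "q ^ n = 1 - (1 - q) * qnum q n"
  by (simp add: one_minus_times_qnum)

lemma qnum_add: "qnum q (m + n) = qnum q m + q ^ m * qnum q n"
  by (induction n) (simp_all add: qnum_Suc power_add algebra_simps)

lemma sum_power_rank:
  fixes U :: "'b::linorder set"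
  assumes "finite U"
  shows "(\<Sum>x\<in>U. q ^ card {y \<in> U. y < x}) = qnum q (card U)"
  using assms
proof (induction rule: finite_linorder_max_induct)
  case (insert b A)
  have "{y \<in> insert b A. y < x} = {y \<in> A. y < x}" if "x \<in> A" for x
    using that insert by auto
  moreover have "{y \<in> insert b A. y < b} = A" "b \<notin> A"
    using insert by auto
  ultimately show ?case
    using insert by (simp add: qnum_Suc)
qed simp

lemma sum_power_rank_rev:
  fixes U :: "'b::linorder set"
  assumes "finite U"
  shows "(\<Sum>x\<in>U. q ^ card {y \<in> U. x < y}) = qnum q (card U)"
  using assms
proof (induction rule: finite_linorder_min_induct)
  case (insert b A)
  have "{y \<in> insert b A. x < y} = {y \<in> A. x < y}" if "x \<in> A" for x
    using that insert by auto
  moreover have "{y \<in> insert b A. b < y} = A" "b \<notin> A"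
    using insert by auto
  ultimately show ?case
    using insert by (simp add: qnum_Suc)
qed simp

section \<open>The operators of letters and places and their commutation\<close>

definition lowering :: "'a::comm_ring_1 \<Rightarrow> (nat \<Rightarrow> 'a) \<Rightarrow> nat \<Rightarrow> 'a" where
  "lowering q \<phi> e = \<phi> e + qnum q (Suc e) * \<phi> (Suc e)"

definition raising :: "'a::comm_ring_1 \<Rightarrow> nat \<Rightarrow> 'a \<Rightarrow> (nat \<Rightarrow> 'a) \<Rightarrow> nat \<Rightarrow> 'a" where
  "raising q s v \<phi> e = (case e of 0 \<Rightarrow> 0 | Suc e' \<Rightarrow> v * \<phi> e') + qnum q (s + e) * \<phi> e"

definition intertwiner :: "'a::comm_ring_1 \<Rightarrow> 'a \<Rightarrow> (nat \<Rightarrow> 'a) \<Rightarrow> nat \<Rightarrow> 'a" where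
  "intertwiner q v \<phi> e =
     (case e of 0 \<Rightarrow> 0 | Suc e' \<Rightarrow> (1 - q) * v * \<phi> e') + (1 - v * q ^ Suc e) * \<phi> e"

text \<open>Rewriting powers of \<open>q\<close> through q-integers makes all coefficients
  polynomials in a few common quantities, which can be compared directly. The factor
  \<open>q\<close> is the growth of the excedance weight from one place to the next.\<close>

lemma intertwining:
  "lowering q (raising q s (q * v) (intertwiner q v \<phi>)) =
   intertwiner q (q * v) (lowering q (raising q s v \<phi>))"
proof
  fix e
  show "lowering q (raising q s (q * v) (intertwiner q v \<phi>)) e =
   intertwiner q (q * v) (lowering q (raising q s v \<phi>)) e"
    by (cases e) (simp_all add: lowering_def raising_def intertwiner_def qnum_Suc qnum_add
        power_eq_qnum algebra_simps split: nat.split)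
qed

text \<open>The ratio of consecutive entries of the state vector after \<open>j < l\<close> places, before any \<open>t\<close> has
  entered: \<open>\<phi> e\<close> is proportional to \<open>binom j e * q ^ (g * e + (e choose 2)) / [s + e]!\<close> (with a
  \<open>q\<close>-binomial coefficient), where \<open>s + e\<close> is the number of letters available for a non-excedance.\<close>
definition balanced :: "'a::comm_ring_1 \<Rightarrow> nat \<Rightarrow> nat \<Rightarrow> nat \<Rightarrow> (nat \<Rightarrow> 'a) \<Rightarrow> bool" where
  "balanced q g s j \<phi> \<longleftrightarrow>
     (\<forall>e. (1 - q ^ (s + Suc e)) * qnum q (Suc e) * \<phi> (Suc e) = q ^ g * (q ^ e - q ^ j) * \<phi> e)"

text \<open>The new entries at \<open>e\<close> and \<open>Suc e\<close> involve three old entries,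
  and two old ratios reduce these to \<open>\<phi> e\<close>. Multiplying by \<open>1 - q\<close>
  turns q-integers into powers; the factor is cancelled at the end.\<close>

lemma balanced_raising:
  fixes q :: "'a::idom"
  assumes "balanced q g (Suc s) j \<phi>" "q \<noteq> 1"
  shows "balanced q g s (Suc j) (raising q (Suc s) (q ^ (j + g)) \<phi>)"
  unfolding balanced_def
proof
  fix e
  have *: "(1 - q ^ (Suc s + Suc e)) * qnum q (Suc e) * \<phi> (Suc e) = q ^ g * (q ^ e - q ^ j) * \<phi> e" for e
    using assms(1) unfolding balanced_def by blast
  define c where "c = 1 - q ^ (s + Suc e)"
  define v where "v = q ^ (j + g)"
  define up where "up = (case e of 0 \<Rightarrow> 0 | Suc e' \<Rightarrow> \<phi> e')"
  \<comment> \<open>At \<open>e = 0\<close> both sides vanish: \<open>up\<close> is \<open>0\<close>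
    by default and \<open>1 - q ^ e = 0\<close>.\<close>
  have up: "(1 - q) * (q ^ g * (q ^ e - q ^ Suc j)) * up = q * c * (1 - q ^ e) * \<phi> e"
  proof (cases e)
    case (Suc e')
    have "(1 - q) * (q ^ g * (q ^ e - q ^ Suc j)) * up = (1 - q) * q * (q ^ g * (q ^ e' - q ^ j) * \<phi> e')"
      by (simp add: up_def Suc algebra_simps)
    also have "\<dots> = (1 - q) * q * (c * qnum q (Suc e') * \<phi> (Suc e'))"
      unfolding *[symmetric] by (simp add: c_def Suc)
    also have "\<dots> = q * c * ((1 - q) * qnum q e) * \<phi> e"
      by (simp add: Suc algebra_simps)
    finally show ?thesis
      by (simp add: one_minus_times_qnum)
  qed (simp add: up_def)
  have "(1 - q) * (c * qnum q (Suc e) * raising q (Suc s) v \<phi> (Suc e)) =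
      c * (v * ((1 - q) * qnum q (Suc e)) * \<phi> e
        + ((1 - q) * qnum q (Suc s + Suc e)) * qnum q (Suc e) * \<phi> (Suc e))"
    by (simp add: raising_def algebra_simps)
  also have "\<dots> = c * (v * (1 - q ^ Suc e) + q ^ g * (q ^ e - q ^ j)) * \<phi> e"
    unfolding one_minus_times_qnum * by (simp add: algebra_simps)
  also have "\<dots> = c * q ^ g * q ^ e * (1 - q * q ^ j) * \<phi> e"
    by (simp add: v_def power_add algebra_simps)
  also have "\<dots> = v * (q * c * (1 - q ^ e) * \<phi> e) + q ^ g * (q ^ e - q ^ Suc j) * c * \<phi> e"
    by (simp add: v_def power_add algebra_simps)
  also have "\<dots> = (1 - q) * (q ^ g * (q ^ e - q ^ Suc j)) * (v * up)
      + q ^ g * (q ^ e - q ^ Suc j) * ((1 - q) * qnum q (Suc s + e)) * \<phi> e"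
    unfolding up[symmetric] one_minus_times_qnum by (simp add: c_def algebra_simps)
  also have "\<dots> = (1 - q) * (q ^ g * (q ^ e - q ^ Suc j) * raising q (Suc s) v \<phi> e)"
    by (cases e) (simp_all add: raising_def up_def algebra_simps)
  finally show "(1 - q ^ (s + Suc e)) * qnum q (Suc e) * raising q (Suc s) (q ^ (j + g)) \<phi> (Suc e) =
     q ^ g * (q ^ e - q ^ Suc j) * raising q (Suc s) (q ^ (j + g)) \<phi> e"
    using assms(2) by (simp add: c_def v_def)
qed

text \<open>The difference of the two sides does not involve \<open>v\<close>, so one value of
  \<open>v\<close> gives all others. Two values matter: \<open>q ^ (j + g)\<close> kills the middle
  term, and \<open>t * q ^ (g + l - 1)\<close> starts the recurrence in \<open>t\<close>.\<close>

lemma balanced_iff: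
  "balanced q g g j \<phi> \<longleftrightarrow>
   (\<forall>e. (1 - q) * lowering q (raising q g v \<phi>) e + (q ^ (j + g) - v) * \<phi> e = intertwiner q v \<phi> e)"
proof -
  have "(1 - q) * lowering q (raising q g v \<phi>) e + (q ^ (j + g) - v) * \<phi> e - intertwiner q v \<phi> e
    = (1 - q ^ (g + Suc e)) * qnum q (Suc e) * \<phi> (Suc e) - q ^ g * (q ^ e - q ^ j) * \<phi> e" for e
    by (cases e) (simp_all add: lowering_def raising_def intertwiner_def qnum_Suc qnum_add
        power_eq_qnum algebra_simps)
  then show ?thesis
    unfolding balanced_def by (metis right_minus_eq)
qed

lemma lowering_raising_linear:
  "lowering q (raising q s v (\<lambda>e. a * \<phi> e + b * \<psi> e)) =
   (\<lambda>e. a * lowering q (raising q s v \<phi>) e + b * lowering q (raising q s v \<psi>) e)"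
proof
  fix e
  show "lowering q (raising q s v (\<lambda>e. a * \<phi> e + b * \<psi> e)) e =
    a * lowering q (raising q s v \<phi>) e + b * lowering q (raising q s v \<psi>) e"
    by (cases e) (simp_all add: lowering_def raising_def algebra_simps)
qed

text \<open>At \<open>v = q ^ (j + g)\<close>, \<open>balanced_iff\<close> makes
  \<open>(1 - q)\<close> times the new vector equal to \<open>intertwiner q v \<phi>\<close>.
  Commuting \<open>intertwiner\<close> past the next step gives the same identity for the new vector
  at \<open>q * v\<close>, the value belonging to \<open>Suc j\<close>.\<close>

lemma balanced_lowering_raising:
  assumes "balanced q g g j \<phi>"
  shows "balanced q g g (Suc j) (lowering q (raising q g (q ^ (j + g)) \<phi>))"
proof -
  let ?v = "q ^ (j + g)" and ?\<psi> = "lowering q (raising q g (q ^ (j + g)) \<phi>)"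
  \<comment> \<open>The zero summand supplies the linear combination expected by
    \<open>lowering_raising_linear\<close>.\<close>
  have "intertwiner q ?v \<phi> = (\<lambda>e. (1 - q) * ?\<psi> e + 0 * ?\<psi> e)"
    using assms unfolding balanced_iff[of q g j \<phi> ?v] by auto
  then have "intertwiner q (q * ?v) ?\<psi> = (\<lambda>e. (1 - q) * lowering q (raising q g (q * ?v) ?\<psi>) e)"
    unfolding intertwining[symmetric] by (simp only: lowering_raising_linear) simp
  then show ?thesis
    unfolding balanced_iff[of q g "Suc j" ?\<psi> "q * ?v"] by simp
qed

subsection \<open>Partial placements\<close>

text \<open>A partial placement sends the places \<open>1..i\<close> injectively to the letters \<open>1..m\<close>, except that
  \<open>e\<close> places, marked by the value \<open>0\<close>, are still waiting for a letter; such a place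
  will be an excedance.\<close>

definition open_places :: "nat \<Rightarrow> (nat \<Rightarrow> nat) \<Rightarrow> nat set" where
  "open_places i p = {x \<in> {1..i}. p x = 0}"

definition placements :: "nat \<Rightarrow> nat \<Rightarrow> nat \<Rightarrow> (nat \<Rightarrow> nat) set" where
  "placements i m e =
     {p. (\<forall>x. x \<notin> {1..i} \<longrightarrow> p x = 0) \<and> (\<forall>x. p x \<le> m) \<and> inj_on p {x. p x \<noteq> 0} \<and>
         card (open_places i p) = e}"

definition exc_places :: "(nat \<Rightarrow> nat) \<Rightarrow> nat \<Rightarrow> (nat \<Rightarrow> nat) \<Rightarrow> nat set" where
  "exc_places h i p = {x \<in> {1..i}. p x = 0 \<or> h x \<le> p x}"

text \<open>An open place will receive a letter larger than all present ones, so it already counts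
  as larger than every filled excedance to its right.\<close>

definition exc_inv :: "(nat \<Rightarrow> nat) \<Rightarrow> nat \<Rightarrow> (nat \<Rightarrow> nat) \<Rightarrow> (nat \<times> nat) set" where
  "exc_inv h i p = {(x, y). x \<in> exc_places h i p \<and> y \<in> exc_places h i p \<and> x < y \<and>
     p y \<noteq> 0 \<and> (p x = 0 \<or> p y < p x)}"

text \<open>A pair \<open>(x, z)\<close> consists of a place and a letter: the letter \<open>z\<close>, if not yet used, will
  stand to the right of \<open>x\<close> as a non-excedance.\<close>
definition nexc_inv :: "(nat \<Rightarrow> nat) \<Rightarrow> nat \<Rightarrow> (nat \<Rightarrow> nat) \<Rightarrow> (nat \<times> nat) set" where
  "nexc_inv h i p = {(x, z). x \<in> {1..i} - exc_places h i p \<and> z \<in> {1..<p x} \<and>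
     z \<notin> p ` ({1..<x} \<union> exc_places h i p)}"

text \<open>\<open>h x\<close> is the least letter that makes \<open>x\<close> an excedance, and
  \<open>u x\<close> is the weight of an excedance there. The recurrences only compare
  \<open>h\<close> with the number of letters that have arrived.\<close>

definition placement_weight ::
    "(nat \<Rightarrow> nat) \<Rightarrow> (nat \<Rightarrow> 'a::comm_ring_1) \<Rightarrow> 'a \<Rightarrow> nat \<Rightarrow> (nat \<Rightarrow> nat) \<Rightarrow> 'a" where
  "placement_weight h u q i p =
     (\<Prod>x\<in>exc_places h i p. u x) * q ^ (card (exc_inv h i p) + card (nexc_inv h i p))"

definition placement_sum ::
    "(nat \<Rightarrow> nat) \<Rightarrow> (nat \<Rightarrow> 'a::comm_ring_1) \<Rightarrow> 'a \<Rightarrow> nat \<Rightarrow> nat \<Rightarrow> nat \<Rightarrow> 'a" where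
  "placement_sum h u q i m e = (\<Sum>p\<in>placements i m e. placement_weight h u q i p)"

lemma finite_open_places [simp]: "finite (open_places i p)"
  by (simp add: open_places_def)

lemma finite_exc_places [simp]: "finite (exc_places h i p)"
  by (simp add: exc_places_def)

lemma finite_exc_inv [simp]: "finite (exc_inv h i p)"
  by (rule finite_subset[of _ "{1..i} \<times> {1..i}"]) (auto simp: exc_inv_def exc_places_def)

lemma finite_nexc_inv [simp]: "finite (nexc_inv h i p)"
proof (rule finite_subset)
  show "nexc_inv h i p \<subseteq> Sigma {1..i} (\<lambda>x. {1..<p x})"
    by (auto simp: nexc_inv_def)
qed auto

lemma finite_placements [simp]: "finite (placements i m e)"
proof (rule finite_subset)
  show "placements i m e \<subseteq> {p. \<forall>x. (x \<in> {1..i} \<longrightarrow> p x \<in> {0..m}) \<and> (x \<notin> {1..i} \<longrightarrow> p x = 0)}"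
    by (auto simp: placements_def)
qed (rule finite_set_of_finite_funs; simp)

lemma placementsD:
  assumes "p \<in> placements i m e"
  shows "x \<notin> {1..i} \<Longrightarrow> p x = 0" "p x \<le> m" "p x \<noteq> 0 \<Longrightarrow> p x = p y \<Longrightarrow> x = y"
    "card (open_places i p) = e"
  using assms by (auto simp: placements_def inj_on_def)

section \<open>Arrival of a letter\<close>

lemma placements_Suc_letter:
  "placements i (Suc m) e = placements i m e \<union>
     (\<lambda>(p, x). p(x := Suc m)) ` Sigma (placements i m (Suc e)) (open_places i)"
  (is "?L = ?A \<union> ?B")
proof (intro equalityI subsetI)
  fix p assume p: "p \<in> ?L"
  show "p \<in> ?A \<union> ?B"
  proof (cases "\<exists>x. p x = Suc m")
    case False
    then have "p x \<le> m" for x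
      using placementsD(2)[OF p, of x] by (metis le_Suc_eq)
    then show ?thesis
      using p by (auto simp: placements_def)
  next
    case True
    then obtain x where x: "p x = Suc m" by blast
    then have x1: "x \<in> {1..i}"
      using placementsD(1)[OF p, of x] by (metis nat.distinct(1))
    have other: "p y \<le> m" if "y \<noteq> x" for y
      using placementsD(2)[OF p, of y] placementsD(3)[OF p, of x y] that x by (auto simp: le_Suc_eq)
    have "open_places i (p(x := 0)) = insert x (open_places i p)" "x \<notin> open_places i p"
      using x x1 by (auto simp: open_places_def)
    then have "card (open_places i (p(x := 0))) = Suc e"
      using placementsD(4)[OF p] by simp
    moreover have "inj_on (p(x := 0)) {y. (p(x := 0)) y \<noteq> 0}"
      using placementsD(3)[OF p] by (auto simp: inj_on_def split: if_splits)
    ultimately have "p(x := 0) \<in> placements i m (Suc e)"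
      using placementsD(1)[OF p] other by (auto simp: placements_def)
    moreover have "x \<in> open_places i (p(x := 0))" "p = (p(x := 0))(x := Suc m)"
      using x x1 by (auto simp: open_places_def)
    ultimately have "p \<in> ?B"
      by (intro image_eqI[where x = "(p(x := 0), x)"]) auto
    then show ?thesis ..
  qed
next
  fix p' assume "p' \<in> ?A \<union> ?B"
  then show "p' \<in> ?L"
  proof
    assume "p' \<in> ?B"
    then obtain p x where p: "p \<in> placements i m (Suc e)" and x: "x \<in> open_places i p"
      and p': "p' = p(x := Suc m)"
      by auto
    have "open_places i p' = open_places i p - {x}"
      by (auto simp: p' open_places_def)
    then have "card (open_places i p') = e"
      using placementsD(4)[OF p] x by simp
    moreover have "p y \<noteq> Suc m" "Suc m \<noteq> p y" for y
      using placementsD(2)[OF p, of y] by auto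
    then have "inj_on p' {y. p' y \<noteq> 0}"
      using placementsD(3)[OF p] by (auto simp: inj_on_def p' split: if_splits)
    moreover have "p' y \<le> Suc m" "y \<notin> {1..i} \<Longrightarrow> p' y = 0" for y
      using placementsD(1,2)[OF p, of y] x by (auto simp: p' open_places_def)
    ultimately show ?thesis
      by (auto simp: placements_def)
  qed (auto simp: placements_def le_SucI)
qed

text \<open>The hypothesis on \<open>h\<close> keeps \<open>x\<close> an excedance. Pairs with
  \<open>x\<close> on the left were counted while \<open>x\<close> was open; the new ones pair
  \<open>x\<close> with the open places to its left, which will get still larger letters.\<close>

lemma placement_weight_Suc_letter:
  assumes p: "p \<in> placements i m e" and x: "x \<in> open_places i p"
    and h: "\<And>y. y \<in> {1..i} \<Longrightarrow> h y \<le> Suc m"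
  shows "placement_weight h u q i (p(x := Suc m)) =
    placement_weight h u q i p * q ^ card {y \<in> open_places i p. y < x}"
proof -
  have px: "p x = 0" "x \<in> {1..i}" "x \<in> exc_places h i p"
    using x by (auto simp: open_places_def exc_places_def)
  have le: "p y \<le> m" for y
    using placementsD(2)[OF p] .
  have exc: "exc_places h i (p(x := Suc m)) = exc_places h i p"
    using h px by (auto simp: exc_places_def)
  have less: "\<not> Suc m < p y" for y
    using le[of y] by simp
  have "exc_inv h i (p(x := Suc m)) = exc_inv h i p \<union> (\<lambda>y. (y, x)) ` {y \<in> open_places i p. y < x}"
  proof (intro set_eqI, clarify)
    fix a b
    show "(a, b) \<in> exc_inv h i (p(x := Suc m)) \<longleftrightarrow>
      (a, b) \<in> exc_inv h i p \<union> (\<lambda>y. (y, x)) ` {y \<in> open_places i p. y < x}"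
      using px h[OF px(2)] less[of a] le[of b]
      by (cases "a = x"; cases "b = x") (auto simp: exc_inv_def exc open_places_def exc_places_def)
  qed
  moreover have "exc_inv h i p \<inter> (\<lambda>y. (y, x)) ` {y \<in> open_places i p. y < x} = {}"
    using px by (auto simp: exc_inv_def)
  moreover have "card ((\<lambda>y. (y, x)) ` {y \<in> open_places i p. y < x}) = card {y \<in> open_places i p. y < x}"
    by (intro card_image) (auto simp: inj_on_def)
  ultimately have 1: "card (exc_inv h i (p(x := Suc m))) =
      card (exc_inv h i p) + card {y \<in> open_places i p. y < x}"
    by (simp add: card_Un_disjoint)
  \<comment> \<open>Only letters below \<open>p y \<le> m\<close> are tested, so neither the new
    value \<open>Suc m\<close> nor the lost value \<open>0\<close> is seen.\<close>
  have "z \<in> (p(x := Suc m)) ` S \<longleftrightarrow> z \<in> p ` S" if "z \<in> {1..<p y}" for y z S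
    using that le[of y] px(1) by (auto simp: image_iff)
  note image = this
  have "(a, z) \<in> nexc_inv h i (p(x := Suc m)) \<longleftrightarrow> (a, z) \<in> nexc_inv h i p" for a z
  proof (cases "a = x")
    case True
    then show ?thesis
      using px by (simp add: nexc_inv_def exc)
  next
    case False
    then show ?thesis
      unfolding nexc_inv_def exc mem_Collect_eq prod.case fun_upd_other[OF False]
      using image[of z a "{1..<a} \<union> exc_places h i p"] by argo
  qed
  then have "nexc_inv h i (p(x := Suc m)) = nexc_inv h i p"
    by auto
  then show ?thesis
    unfolding placement_weight_def exc 1 by (simp add: power_add mult_ac)
qed

text \<open>A letter acts as \<open>lowering\<close>: the ranks of the \<open>Suc e\<close> open
  places sum to a q-integer.\<close>

lemma placement_sum_Suc_letter:
  assumes h: "\<And>y. y \<in> {1..i} \<Longrightarrow> h y \<le> Suc m"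
  shows "placement_sum h u q i (Suc m) e =
    placement_sum h u q i m e + qnum q (Suc e) * placement_sum h u q i m (Suc e)"
proof -
  let ?B = "Sigma (placements i m (Suc e)) (open_places i)"
  let ?f = "\<lambda>(p, x). p(x := Suc m) :: nat \<Rightarrow> nat"
  have ne: "p y \<noteq> Suc m" if "p \<in> placements i m e'" for p y e'
    using placementsD(2)[OF that, of y] by simp
  have inj: "inj_on ?f ?B"
  proof (rule inj_onI, clarify)
    fix p x p' x'
    assume p: "p \<in> placements i m (Suc e)" "x \<in> open_places i p"
      and p': "p' \<in> placements i m (Suc e)" "x' \<in> open_places i p'"
      and eq: "p(x := Suc m) = p'(x' := Suc m)"
    have "x = x'"
      using fun_cong[OF eq, of x] ne[OF p'(1)] by (auto split: if_splits)
    moreover have "p y = p' y" for y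
      using fun_cong[OF eq, of y] p(2) p'(2) \<open>x = x'\<close>
      by (cases "y = x") (auto simp: open_places_def)
    ultimately show "p = p' \<and> x = x'"
      by auto
  qed
  have "p' \<notin> placements i m e" if p': "p' \<in> ?f ` ?B" for p'
  proof -
    obtain px where "p' = (fst px)(snd px := Suc m)"
      using p' by (auto simp: case_prod_unfold)
    then show ?thesis
      using ne[of p' e "snd px"] by auto
  qed
  then have "placements i m e \<inter> ?f ` ?B = {}"
    by blast
  then have "placement_sum h u q i (Suc m) e = placement_sum h u q i m e +
      (\<Sum>p'\<in>?f ` ?B. placement_weight h u q i p')"
    unfolding placement_sum_def placements_Suc_letter by (intro sum.union_disjoint) auto
  also have "(\<Sum>p'\<in>?f ` ?B. placement_weight h u q i p') =
      (\<Sum>(p, x)\<in>?B. placement_weight h u q i (p(x := Suc m)))"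
    by (subst sum.reindex[OF inj]) (simp add: case_prod_unfold)
  also have "\<dots> = (\<Sum>p\<in>placements i m (Suc e). \<Sum>x\<in>open_places i p.
      placement_weight h u q i (p(x := Suc m)))"
    by (subst sum.Sigma) auto
  also have "\<dots> = (\<Sum>p\<in>placements i m (Suc e). placement_weight h u q i p *
      (\<Sum>x\<in>open_places i p. q ^ card {y \<in> open_places i p. y < x}))"
    unfolding sum_distrib_left using h by (intro sum.cong refl placement_weight_Suc_letter)
  also have "\<dots> = (\<Sum>p\<in>placements i m (Suc e). placement_weight h u q i p * qnum q (Suc e))"
    by (intro sum.cong refl) (simp add: sum_power_rank placementsD(4))
  finally show ?thesis
    by (simp add: placement_sum_def sum_distrib_left mult.commute)
qed

section \<open>Arrival of a place\<close>

text \<open>Unvisited and open places both carry the value \<open>0\<close>, so leaving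
  \<open>Suc i\<close> open keeps the function and only changes the count of open places.\<close>

lemma placements_Suc_place:
  "placements (Suc i) m e = (case e of 0 \<Rightarrow> {} | Suc e' \<Rightarrow> placements i m e') \<union>
     (\<lambda>(p, z). p(Suc i := z)) ` Sigma (placements i m e) (\<lambda>p. {1..m} - range p)"
  (is "?L = ?A \<union> ?B")
proof (intro equalityI subsetI)
  fix p assume p: "p \<in> ?L"
  show "p \<in> ?A \<union> ?B"
  proof (cases "p (Suc i) = 0")
    case True
    then have "open_places (Suc i) p = insert (Suc i) (open_places i p)"
      by (auto simp: open_places_def le_Suc_eq)
    then have "e = Suc (card (open_places i p))"
      using placementsD(4)[OF p] by (simp add: open_places_def)
    moreover have "p x = 0" if "x \<notin> {1..i}" for x
      using placementsD(1)[OF p, of x] True that by (cases "x = Suc i") auto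
    ultimately have "p \<in> ?A"
      using p by (auto simp: placements_def)
    then show ?thesis ..
  next
    case False
    define p0 where "p0 = p(Suc i := 0)"
    have "open_places (Suc i) p = open_places i p0"
      using False by (auto simp: open_places_def p0_def le_Suc_eq)
    then have "card (open_places i p0) = e"
      using placementsD(4)[OF p] by simp
    moreover have "inj_on p0 {y. p0 y \<noteq> 0}"
      using p by (auto simp: inj_on_def p0_def placements_def split: if_splits)
    moreover have "p0 x = 0" if "x \<notin> {1..i}" for x
      using placementsD(1)[OF p, of x] that by (cases "x = Suc i") (auto simp: p0_def)
    ultimately have "p0 \<in> placements i m e"
      using placementsD(2)[OF p] by (auto simp: placements_def p0_def)
    moreover have "p (Suc i) \<noteq> p0 x" for x
      using False placementsD(3)[OF p, of "Suc i" x] by (auto simp: p0_def)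
    then have "p (Suc i) \<in> {1..m} - range p0"
      using False placementsD(2)[OF p, of "Suc i"] by auto
    moreover have "p = p0(Suc i := p (Suc i))"
      by (auto simp: p0_def)
    ultimately have "p \<in> ?B"
      by (intro image_eqI[where x = "(p0, p (Suc i))"]) auto
    then show ?thesis ..
  qed
next
  fix p' assume "p' \<in> ?A \<union> ?B"
  then show "p' \<in> ?L"
  proof
    assume "p' \<in> ?A"
    then obtain e' where e: "e = Suc e'" and p: "p' \<in> placements i m e'"
      by (auto split: nat.splits)
    have "open_places (Suc i) p' = insert (Suc i) (open_places i p')"
      using placementsD(1)[OF p, of "Suc i"] by (auto simp: open_places_def le_Suc_eq)
    then have "card (open_places (Suc i) p') = e"
      using placementsD(4)[OF p] e by (simp add: open_places_def)
    then show ?thesis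
      using p by (auto simp: placements_def)
  next
    assume "p' \<in> ?B"
    then obtain p z where p: "p \<in> placements i m e" and z: "z \<in> {1..m}" "z \<notin> range p"
      and p': "p' = p(Suc i := z)"
      by auto
    have "open_places (Suc i) p' = open_places i p"
      using z by (auto simp: p' open_places_def le_Suc_eq)
    then have "card (open_places (Suc i) p') = e"
      using placementsD(4)[OF p] by simp
    moreover have "p y \<noteq> z" "z \<noteq> p y" for y
      using z by auto
    then have "inj_on p' {y. p' y \<noteq> 0}"
      using p by (auto simp: inj_on_def p' placements_def split: if_splits)
    moreover have "p' y \<le> m" "y \<notin> {1..Suc i} \<Longrightarrow> p' y = 0" for y
      using placementsD(1,2)[OF p, of y] z by (auto simp: p')
    ultimately show ?thesis
      by (auto simp: placements_def)
  qed
qed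

text \<open>The new place is rightmost and open, so it ends no pair of \<open>exc_inv\<close>; among
  the excluded letters of \<open>nexc_inv\<close> it contributes only the value
  \<open>0\<close>.\<close>

lemma placement_weight_Suc_place_open:
  assumes p: "p \<in> placements i m e"
  shows "placement_weight h u q (Suc i) p = u (Suc i) * placement_weight h u q i p"
proof -
  have p0: "p (Suc i) = 0"
    using placementsD(1)[OF p] by simp
  have exc: "exc_places h (Suc i) p = insert (Suc i) (exc_places h i p)" "Suc i \<notin> exc_places h i p"
    using p0 by (auto simp: exc_places_def le_Suc_eq)
  have "x \<le> i" if "x \<in> exc_places h i p" for x
    using that by (simp add: exc_places_def)
  then have "exc_inv h (Suc i) p = exc_inv h i p"
    unfolding exc_inv_def exc using p0 by fastforce
  moreover have "nexc_inv h (Suc i) p = nexc_inv h i p"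
    unfolding nexc_inv_def exc using p0 exc(2) by (auto simp: le_Suc_eq)
  ultimately show ?thesis
    unfolding placement_weight_def using exc by (simp add: mult_ac)
qed

lemma placement_weight_Suc_place_closed:
  assumes p: "p \<in> placements i m e" and z: "z \<in> {1..m} - range p" and h: "m < h (Suc i)"
  shows "placement_weight h u q (Suc i) (p(Suc i := z)) =
    placement_weight h u q i p * q ^ card {y \<in> {1..m} - range p. y < z}"
proof -
  let ?p = "p(Suc i := z)"
  let ?F = "{y \<in> {1..m} - range p. y < z}"
  have exc: "exc_places h (Suc i) ?p = exc_places h i p"
    using h z by (auto simp: exc_places_def le_Suc_eq)
  have le: "x \<le> i" if "x \<in> exc_places h i p" for x
    using that by (simp add: exc_places_def)
  have p0: "p (Suc i) = 0"
    using placementsD(1)[OF p] by simp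
  have "exc_inv h (Suc i) ?p = exc_inv h i p"
    unfolding exc_inv_def exc by (auto dest: le)
  have "y \<in> p ` ({1..i} \<union> exc_places h i p)" if "y = p x" "y \<noteq> 0" for x y
  proof -
    have "x \<in> {1..i}"
      using that placementsD(1)[OF p, of x] by metis
    then show ?thesis
      using that by auto
  qed
  then have used: "y \<in> p ` ({1..i} \<union> exc_places h i p) \<longleftrightarrow> y \<in> range p" if "y \<noteq> 0" for y
    using that by auto
  have upd: "?p ` S = p ` S" if "S \<subseteq> {..i}" for S
    using that by (auto simp: image_iff Bex_def)
  have exc_sub: "exc_places h i p \<subseteq> {..i}"
    using le by auto
  have "nexc_inv h (Suc i) ?p = nexc_inv h i p \<union> Pair (Suc i) ` ?F"
  proof (intro set_eqI, clarify)
    fix x y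
    consider "x = Suc i" | "x \<le> i" | "x > Suc i" by linarith
    then show "(x, y) \<in> nexc_inv h (Suc i) ?p \<longleftrightarrow> (x, y) \<in> nexc_inv h i p \<union> Pair (Suc i) ` ?F"
    proof cases
      case 1
      have "?p ` ({1..<Suc i} \<union> exc_places h i p) = p ` ({1..i} \<union> exc_places h i p)"
        using exc_sub by (subst upd) (auto simp: atLeastLessThanSuc_atLeastAtMost)
      then show ?thesis
        using 1 z used[of y] exc_sub by (auto simp: nexc_inv_def exc)
    next
      case 2
      then have "?p ` ({1..<x} \<union> exc_places h i p) = p ` ({1..<x} \<union> exc_places h i p)"
        using exc_sub by (intro upd) auto
      then show ?thesis
        using 2 by (auto simp: nexc_inv_def exc)
    qed (auto simp: nexc_inv_def)
  qed
  moreover have "nexc_inv h i p \<inter> Pair (Suc i) ` ?F = {}"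
    by (auto simp: nexc_inv_def)
  moreover have "card (Pair (Suc i) ` ?F) = card ?F"
    by (intro card_image) (auto simp: inj_on_def)
  ultimately have "card (nexc_inv h (Suc i) ?p) = card (nexc_inv h i p) + card ?F"
    by (simp add: card_Un_disjoint)
  then show ?thesis
    unfolding placement_weight_def exc \<open>exc_inv h (Suc i) ?p = _\<close> by (simp add: power_add mult_ac)
qed

text \<open>The \<open>i - e\<close> places that are not open use distinct letters.\<close>

lemma card_unused_letters:
  assumes p: "p \<in> placements i m e" and "i \<le> m"
  shows "card ({1..m} - range p) = m - i + e"
proof -
  let ?N = "{x. p x \<noteq> 0}"
  have "x \<in> {1..i}" if "p x \<noteq> 0" for x
    using placementsD(1)[OF p, of x] that by blast
  then have "?N = {1..i} - open_places i p"
    by (auto simp: open_places_def)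
  then have "card ?N = i - e"
    using placementsD(4)[OF p] by (simp add: card_Diff_subset open_places_def subset_iff)
  moreover have "card (p ` ?N) = card ?N"
    using p by (intro card_image) (simp add: placements_def)
  moreover have "{1..m} - range p = {1..m} - p ` ?N" "p ` ?N \<subseteq> {1..m}"
    using placementsD(2)[OF p] by auto
  moreover have "e \<le> i"
    using placementsD(4)[OF p] card_mono[of "{1..i}" "open_places i p"] by (simp add: open_places_def subset_iff)
  ultimately show ?thesis
    using \<open>i \<le> m\<close> by (simp add: card_Diff_subset finite_subset[of _ "{1..m}"])
qed

text \<open>A place acts as \<open>raising\<close> with \<open>s = m - i\<close>.\<close>

lemma placement_sum_Suc_place:
  assumes h: "m < h (Suc i)" and "i \<le> m"
  shows "placement_sum h u q (Suc i) m e =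
    (case e of 0 \<Rightarrow> 0 | Suc e' \<Rightarrow> u (Suc i) * placement_sum h u q i m e') +
    qnum q (m - i + e) * placement_sum h u q i m e"
proof -
  let ?A = "case e of 0 \<Rightarrow> {} | Suc e' \<Rightarrow> placements i m e'"
  let ?B = "Sigma (placements i m e) (\<lambda>p. {1..m} - range p)"
  let ?f = "\<lambda>(p, z). p(Suc i := z) :: nat \<Rightarrow> nat"
  have p0: "p (Suc i) = 0" if "p \<in> placements i m e'" for p e'
    using placementsD(1)[OF that] by simp
  have inj: "inj_on ?f ?B"
  proof (rule inj_onI, clarify)
    fix p z p' z'
    assume p: "p \<in> placements i m e" and p': "p' \<in> placements i m e"
      and eq: "p(Suc i := z) = p'(Suc i := z')"
    have "p y = p' y" for y
      using fun_cong[OF eq, of y] p0[OF p] p0[OF p'] by (cases "y = Suc i") auto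
    then show "p = p' \<and> z = z'"
      using fun_cong[OF eq, of "Suc i"] by auto
  qed
  have "?A \<inter> ?f ` ?B = {}"
    using p0 by (force split: nat.splits)
  moreover have "finite ?A"
    by (simp split: nat.split)
  ultimately have "placement_sum h u q (Suc i) m e =
      (\<Sum>p\<in>?A. placement_weight h u q (Suc i) p) +
      (\<Sum>p'\<in>?f ` ?B. placement_weight h u q (Suc i) p')"
    unfolding placement_sum_def placements_Suc_place by (intro sum.union_disjoint) auto
  also have "(\<Sum>p'\<in>?f ` ?B. placement_weight h u q (Suc i) p') =
      (\<Sum>(p, z)\<in>?B. placement_weight h u q (Suc i) (p(Suc i := z)))"
    by (subst sum.reindex[OF inj]) (simp add: case_prod_unfold)
  also have "\<dots> = (\<Sum>p\<in>placements i m e. \<Sum>z\<in>{1..m} - range p.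
      placement_weight h u q (Suc i) (p(Suc i := z)))"
    by (subst sum.Sigma) auto
  also have "\<dots> = (\<Sum>p\<in>placements i m e. placement_weight h u q i p *
      (\<Sum>z\<in>{1..m} - range p. q ^ card {y \<in> {1..m} - range p. y < z}))"
    unfolding sum_distrib_left using h
    by (intro sum.cong refl placement_weight_Suc_place_closed)
  also have "\<dots> = (\<Sum>p\<in>placements i m e. placement_weight h u q i p * qnum q (m - i + e))"
    using \<open>i \<le> m\<close> by (intro sum.cong refl) 
      (simp only: sum_power_rank finite_Diff finite_atLeastAtMost card_unused_letters)
  also have "(\<Sum>p\<in>?A. placement_weight h u q (Suc i) p) =
      (case e of 0 \<Rightarrow> 0 | Suc e' \<Rightarrow> u (Suc i) * placement_sum h u q i m e')"
    by (auto split: nat.split simp: placement_sum_def sum_distrib_left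
        intro!: sum.cong placement_weight_Suc_place_open)
  finally show ?thesis
    by (simp add: placement_sum_def sum_distrib_left mult.commute)
qed

lemma placement_sum_0:
  "placement_sum h u q 0 m e = (if e = 0 then 1 else 0)"
proof -
  have "placements 0 m e = (if e = 0 then {\<lambda>_. 0} else {})"
    by (auto simp: placements_def open_places_def)
  then show ?thesis
    by (simp add: placement_sum_def placement_weight_def exc_places_def exc_inv_def nexc_inv_def)
qed

subsection \<open>Inserting the largest letter\<close>

text \<open>Since \<open>\<pi> \<in> Sym n\<close> fixes \<open>Suc n\<close>, composing with this
  cycle writes \<open>Suc n\<close> right behind place \<open>p\<close> and shifts the later letters
  by one.\<close>

definition slot_cycle :: "nat \<Rightarrow> nat \<Rightarrow> nat \<Rightarrow> nat" where
  "slot_cycle n p x = (if x \<le> p \<or> Suc n < x then x else if x = Suc p then Suc n else x - 1)"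

definition insert_max :: "nat \<Rightarrow> (nat \<Rightarrow> nat) \<Rightarrow> nat \<Rightarrow> nat \<Rightarrow> nat" where
  "insert_max n \<pi> p = \<pi> \<circ> slot_cycle n p"

text \<open>The new position of the old place \<open>x\<close>; the value \<open>Suc p\<close> is
  skipped for the inserted letter.\<close>

definition bump :: "nat \<Rightarrow> nat \<Rightarrow> nat" where
  "bump p x = (if x \<le> p then x else Suc x)"

lemma Sym_fixes: "\<pi> \<in> Sym n \<Longrightarrow> n < x \<Longrightarrow> \<pi> x = x"
  by (auto simp: Sym_def permutes_def)

lemma Sym_range: "\<pi> \<in> Sym n \<Longrightarrow> x \<in> {1..n} \<Longrightarrow> \<pi> x \<in> {1..n}"
  by (metis Sym_def mem_Collect_eq permutes_in_image)

lemma Sym_inj: "\<pi> \<in> Sym n \<Longrightarrow> inj \<pi>"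
  by (simp add: Sym_def permutes_inj)

lemma finite_Sym [simp]: "finite (Sym n)"
  by (simp add: Sym_def finite_permutations)

lemma slot_cycle_permutes:
  assumes "p \<le> n"
  shows "slot_cycle n p permutes {1..Suc n}"
proof (rule bij_imp_permutes)
  have "inj_on (slot_cycle n p) {1..Suc n}"
    by (auto simp: inj_on_def slot_cycle_def split: if_splits)
  moreover have "slot_cycle n p ` {1..Suc n} \<subseteq> {1..Suc n}"
    by (auto simp: slot_cycle_def)
  ultimately show "bij_betw (slot_cycle n p) {1..Suc n} {1..Suc n}"
    by (simp add: bij_betw_def endo_inj_surj)
qed (use assms in \<open>auto simp: slot_cycle_def\<close>)

lemma insert_max_Sym:
  assumes "\<pi> \<in> Sym n" "p \<le> n"
  shows "insert_max n \<pi> p \<in> Sym (Suc n)"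
proof -
  have "\<pi> permutes {1..Suc n}"
    using assms(1) unfolding Sym_def by (auto intro: permutes_subset)
  then show ?thesis
    using permutes_compose[OF slot_cycle_permutes[OF assms(2)]] by (simp add: Sym_def insert_max_def)
qed

lemma insert_max_slot:
  assumes "\<pi> \<in> Sym n" "p \<le> n"
  shows "insert_max n \<pi> p (Suc p) = Suc n"
  using assms Sym_fixes[of \<pi> n "Suc n"] by (simp add: insert_max_def slot_cycle_def)

lemma insert_max_bump:
  assumes "x \<le> n"
  shows "insert_max n \<pi> p (bump p x) = \<pi> x"
  using assms by (simp add: insert_max_def slot_cycle_def bump_def)

text \<open>The position of the letter \<open>Suc n\<close> determines \<open>p\<close>, and then
  the cycle cancels. Surjectivity follows by counting.\<close>

lemma bij_betw_insert_max:
  "bij_betw (\<lambda>(\<pi>, p). insert_max n \<pi> p) (Sym n \<times> {0..n}) (Sym (Suc n))"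
proof -
  let ?f = "\<lambda>(\<pi>, p). insert_max n \<pi> p"
  have inj: "inj_on ?f (Sym n \<times> {0..n})"
  proof (rule inj_onI, clarify)
    fix \<pi> p \<pi>' p'
    assume \<pi>: "\<pi> \<in> Sym n" "p \<in> {0..n}" and \<pi>': "\<pi>' \<in> Sym n" "p' \<in> {0..n}"
      and eq: "insert_max n \<pi> p = insert_max n \<pi>' p'"
    have "insert_max n \<pi> p (Suc p) = insert_max n \<pi> p (Suc p')"
      using \<pi> \<pi>' insert_max_slot[of \<pi> n p] insert_max_slot[of \<pi>' n p'] by (simp add: eq)
    moreover have "inj (insert_max n \<pi> p)"
      using \<pi> by (intro Sym_inj[OF insert_max_Sym]) auto
    ultimately have p: "p = p'"
      by (auto dest: injD)
    have surj: "surj (slot_cycle n p)"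
      using slot_cycle_permutes[of p n] \<pi>(2) permutes_surj by auto
    have "\<pi> x = \<pi>' x" for x
      using surjD[OF surj, of x] fun_cong[OF eq] by (auto simp: p insert_max_def)
    then have "\<pi> = \<pi>'" ..
    with p show "\<pi> = \<pi>' \<and> p = p'"
      by simp
  qed
  have "card (?f ` (Sym n \<times> {0..n})) = card (Sym (Suc n))"
    unfolding card_image[OF inj] by (simp add: card_cartesian_product Sym_def card_permutations)
  moreover have "?f ` (Sym n \<times> {0..n}) \<subseteq> Sym (Suc n)"
    using insert_max_Sym by auto
  ultimately have "?f ` (Sym n \<times> {0..n}) = Sym (Suc n)"
    by (intro card_subset_eq) auto
  with inj show ?thesis
    by (simp add: bij_betw_def)
qed

section \<open>Effect of an insertion on descents and inversions\<close>

text \<open>A descent at \<open>p\<close> is destroyed because a larger letter now follows; descents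
  behind \<open>p\<close> move one place to the right.\<close>

lemma rDes_insert_max:
  assumes \<pi>: "\<pi> \<in> Sym n" and p: "p \<le> n" and r: "r \<ge> 1"
  shows "rDes r (Suc n) (insert_max n \<pi> p) =
    {i \<in> rDes r n \<pi>. i < p} \<union> (if p < n \<and> \<pi> (Suc p) + r \<le> Suc n then {Suc p} else {}) \<union>
    Suc ` {i \<in> rDes r n \<pi>. p < i}" (is "_ = ?D")
proof (rule set_eqI)
  fix i
  have val: "insert_max n \<pi> p x = (if x \<le> p then \<pi> x else if x = Suc p then Suc n else \<pi> (x - 1))"
    if "x \<le> Suc n" for x
    using that Sym_fixes[OF \<pi>, of "Suc n"] by (simp add: insert_max_def slot_cycle_def)
  consider "i \<notin> {1..n}" | "i \<in> {1..n}" "i < p" | "i \<in> {1..n}" "i = p" | "i \<in> {1..n}" "i = Suc p"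
    | "i \<in> {1..n}" "i > Suc p"
    by fastforce
  then show "i \<in> rDes r (Suc n) (insert_max n \<pi> p) \<longleftrightarrow> i \<in> ?D"
  proof cases
    case 1
    then show ?thesis using p by (auto simp: rDes_def)
  next
    case 2
    then show ?thesis using p by (auto simp: rDes_def val)
  next
    case 3
    then have "\<pi> i \<le> n" using Sym_range[OF \<pi>, of i] by simp
    then show ?thesis using 3 r by (auto simp: rDes_def val)
  next
    case 4
    then show ?thesis by (auto simp: rDes_def val)
  next
    case 5
    then obtain k where "i = Suc k" by (cases i) auto
    then show ?thesis using 5 by (auto simp: rDes_def val)
  qed
qed

text \<open>\<open>bump p\<close> carries the old pairs over. The largest letter can only be the
  left member of a new pair, and its partners are the large letters behind it.\<close>

lemma card_rInv_insert_max:
  assumes \<pi>: "\<pi> \<in> Sym n" and p: "p \<le> n"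
  shows "card (rInv r (Suc n) (insert_max n \<pi> p)) =
    card (rInv r n \<pi>) + card {x \<in> {Suc p..n}. Suc n < \<pi> x + r}"
proof -
  let ?b = "bump p" and ?\<pi> = "insert_max n \<pi> p"
  let ?X = "map_prod ?b ?b ` rInv r n \<pi>"
  let ?U = "{x \<in> {Suc p..n}. Suc n < \<pi> x + r}"
  let ?Y = "(\<lambda>x. (Suc p, ?b x)) ` ?U"
  have bump_less: "?b x < ?b y \<longleftrightarrow> x < y" for x y
    by (auto simp: bump_def)
  have inj: "inj ?b"
    by (rule injI) (auto simp: bump_def split: if_splits)
  have ne: "?b x \<noteq> Suc p" for x
    by (auto simp: bump_def)
  have range: "?b x \<in> {1..Suc n} \<longleftrightarrow> x \<in> {1..n}" if "x \<le> n" for x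
    using p that by (auto simp: bump_def)
  have split: "i = Suc p \<or> (\<exists>x\<in>{1..n}. i = ?b x)" if "i \<in> {1..Suc n}" for i
  proof -
    consider "i \<le> p" | "i = Suc p" | "i > Suc p" by linarith
    then show ?thesis
    proof cases
      case 1
      then show ?thesis using that p by (intro disjI2 bexI[of _ i]) (auto simp: bump_def)
    next
      case 3
      then show ?thesis using that p by (intro disjI2 bexI[of _ "i - 1"]) (auto simp: bump_def)
    qed auto
  qed
  have top: "?\<pi> (Suc p) = Suc n"
    by (rule insert_max_slot[OF \<pi> p])
  have val: "?\<pi> (?b x) = \<pi> x" "\<pi> x \<le> n" if "x \<in> {1..n}" for x
    using that insert_max_bump[of x n \<pi> p] Sym_range[OF \<pi>, of x] by auto
  have "rInv r (Suc n) ?\<pi> = ?X \<union> ?Y"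
  proof (intro equalityI subsetI)
    fix ij assume "ij \<in> rInv r (Suc n) ?\<pi>"
    then obtain i j where ij: "ij = (i, j)" "i \<in> {1..Suc n}" "j \<in> {1..Suc n}" "i < j"
        "?\<pi> i > ?\<pi> j" "?\<pi> i < ?\<pi> j + r"
      by (auto simp: rInv_def)
    have "j \<noteq> Suc p"
    proof
      assume j: "j = Suc p"
      then obtain x where x: "x \<in> {1..n}" "i = ?b x"
        using split[OF ij(2)] ij(4) by blast
      then show False
        using ij(5) j top val[OF x(1)] by simp
    qed
    then obtain y where y: "y \<in> {1..n}" "j = ?b y"
      using split[OF ij(3)] by blast
    show "ij \<in> ?X \<union> ?Y"
    proof (cases "i = Suc p")
      case True
      then have "y \<in> ?U"
        using ij y top val[OF y(1)] by (auto simp: bump_def split: if_splits)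
      then show ?thesis
        using ij(1) y(2) True by auto
    next
      case False
      then obtain x where x: "x \<in> {1..n}" "i = ?b x"
        using split[OF ij(2)] by blast
      have "(x, y) \<in> rInv r n \<pi>"
        using x y ij val[OF x(1)] val[OF y(1)] by (auto simp: rInv_def bump_less)
      then show ?thesis
        using ij(1) x y by force
    qed
  next
    fix ij assume "ij \<in> ?X \<union> ?Y"
    then show "ij \<in> rInv r (Suc n) ?\<pi>"
    proof
      assume "ij \<in> ?X"
      then obtain x y where xy: "ij = (?b x, ?b y)" "(x, y) \<in> rInv r n \<pi>"
        by auto
      then have "x \<in> {1..n}" "y \<in> {1..n}"
        by (auto simp: rInv_def)
      then show ?thesis
        using xy range[of x] range[of y] val[of x] val[of y] by (simp add: rInv_def bump_less)
    next
      assume "ij \<in> ?Y"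
      then obtain x where x: "x \<in> ?U" "ij = (Suc p, ?b x)"
        by auto
      then show ?thesis
        using range[of x] val[of x] top p by (auto simp: rInv_def bump_def)
    qed
  qed
  moreover have "?X \<inter> ?Y = {}"
    using ne ne[symmetric] by auto
  moreover have "card ?X = card (rInv r n \<pi>)"
    using inj by (intro card_image inj_on_subset[OF prod.inj_map]) auto
  moreover have "card ?Y = card ?U"
    using inj by (intro card_image) (auto simp: inj_on_def)
  moreover have "finite (rInv r n \<pi>)"
    by (rule finite_subset[of _ "{1..n} \<times> {1..n}"]) (auto simp: rInv_def)
  ultimately show ?thesis
    by (simp add: card_Un_disjoint)
qed

text \<open>Inserting the letter \<open>n + 1\<close> behind place \<open>p\<close> creates no new \<open>r\<close>-descent exactly
  if \<open>p\<close> is in this set.\<close>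
definition quiet_slots :: "nat \<Rightarrow> nat \<Rightarrow> (nat \<Rightarrow> nat) \<Rightarrow> nat set" where
  "quiet_slots r n \<pi> = insert n ({p \<in> {0..<n}. Suc n < \<pi> (Suc p) + r} \<union> rDes r n \<pi>)"

lemma finite_rDes [simp]: "finite (rDes r n \<pi>)"
  by (simp add: rDes_def)

lemma finite_quiet_slots [simp]: "finite (quiet_slots r n \<pi>)"
  by (simp add: quiet_slots_def)

lemma rDes_small:
  assumes "\<pi> \<in> Sym n" "i \<in> rDes r n \<pi>"
  shows "i \<in> {1..<n}" "\<pi> (Suc i) + r \<le> n"
proof -
  show i: "i \<in> {1..<n}"
    using assms(2) by (auto simp: rDes_def)
  then show "\<pi> (Suc i) + r \<le> n"
    using Sym_range[OF assms(1), of i] assms(2) by (simp add: rDes_def)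
qed

lemma quiet_slots_subset:
  assumes "\<pi> \<in> Sym n" shows "quiet_slots r n \<pi> \<subseteq> {0..n}"
  using rDes_small(1)[OF assms] by (fastforce simp: quiet_slots_def)

text \<open>The letters in question are exactly \<open>n + 2 - r\<close>, ...,
  \<open>n\<close>.\<close>

lemma card_big_places:
  assumes "\<pi> \<in> Sym n" "r \<ge> 1" "r \<le> n"
  shows "card {p \<in> {0..<n}. Suc n < \<pi> (Suc p) + r} = r - 1"
proof -
  let ?B = "{p \<in> {0..<n}. Suc n < \<pi> (Suc p) + r}"
  have "(\<lambda>p. \<pi> (Suc p)) ` ?B = {n + 2 - r..n}"
  proof (intro equalityI subsetI)
    fix y assume y: "y \<in> {n + 2 - r..n}"
    then have "y \<in> \<pi> ` {1..n}"
      using assms permutes_image[of \<pi> "{1..n}"] by (auto simp: Sym_def)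
    then obtain x where "x \<in> {1..n}" "y = \<pi> x" by blast
    then show "y \<in> (\<lambda>p. \<pi> (Suc p)) ` ?B"
      using y by (intro image_eqI[of _ _ "x - 1"]) auto
  next
    fix y assume "y \<in> (\<lambda>p. \<pi> (Suc p)) ` ?B"
    then obtain p where p: "p < n" "Suc n < \<pi> (Suc p) + r" "y = \<pi> (Suc p)"
      by auto
    then show "y \<in> {n + 2 - r..n}"
      using Sym_range[OF assms(1), of "Suc p"] by auto
  qed
  moreover have "inj_on (\<lambda>p. \<pi> (Suc p)) ?B"
    using Sym_inj[OF assms(1)] by (auto simp: inj_on_def)
  ultimately have "card ?B = card {n + 2 - r..n}"
    using card_image by fastforce
  then show ?thesis
    using assms by simp
qed

text \<open>If \<open>Suc n \<le> r\<close>, every letter is close enough to \<open>Suc n\<close>.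
  Otherwise the end slot, the \<open>r - 1\<close> slots before large letters and the descents are
  disjoint: by \<open>rDes_small\<close> a descent is followed by a letter at most
  \<open>n - r\<close>.\<close>

lemma card_quiet_slots:
  assumes \<pi>: "\<pi> \<in> Sym n" and r: "r \<ge> 1"
  shows "card (quiet_slots r n \<pi>) = (if Suc n \<le> r then Suc n else rdes r n \<pi> + r)"
proof (cases "Suc n \<le> r")
  case True
  have "{0..n} \<subseteq> quiet_slots r n \<pi>"
  proof
    fix p assume "p \<in> {0..n}"
    then show "p \<in> quiet_slots r n \<pi>"
      using True Sym_range[OF \<pi>, of "Suc p"] by (cases "p = n") (auto simp: quiet_slots_def)
  qed
  then have "quiet_slots r n \<pi> = {0..n}"
    using quiet_slots_subset[OF \<pi>] by blast
  then show ?thesis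
    using True by simp
next
  case False
  let ?B = "{p \<in> {0..<n}. Suc n < \<pi> (Suc p) + r}"
  have "?B \<inter> rDes r n \<pi> = {}" "n \<notin> ?B \<union> rDes r n \<pi>"
    using rDes_small[OF \<pi>] by fastforce+
  then have "card (quiet_slots r n \<pi>) = Suc (card ?B + card (rDes r n \<pi>))"
    unfolding quiet_slots_def by (subst card_insert_disjoint) (auto simp: card_Un_disjoint)
  then show ?thesis
    using False r card_big_places[OF \<pi> r] by (simp add: rdes_def)
qed

lemma sum_split_at:
  fixes A :: "nat set"
  assumes "finite A"
  shows "sum f A = sum f {i \<in> A. i < p} + (if p \<in> A then f p else 0) + sum f {i \<in> A. p < i}"
proof -
  have "A = ({i \<in> A. i < p} \<union> (A \<inter> {p})) \<union> {i \<in> A. p < i}"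
    by auto
  then have "sum f A = sum f (({i \<in> A. i < p} \<union> (A \<inter> {p})) \<union> {i \<in> A. p < i})"
    by simp
  also have "\<dots> = sum f ({i \<in> A. i < p} \<union> (A \<inter> {p})) + sum f {i \<in> A. p < i}"
    using assms by (intro sum.union_disjoint) auto
  also have "sum f ({i \<in> A. i < p} \<union> (A \<inter> {p})) = sum f {i \<in> A. i < p} + sum f (A \<inter> {p})"
    using assms by (intro sum.union_disjoint) auto
  finally show ?thesis
    by simp
qed

lemma card_split_at:
  fixes A :: "nat set"
  assumes "finite A"
  shows "card A = card {i \<in> A. i < p} + (if p \<in> A then 1 else 0) + card {i \<in> A. p < i}"
  using sum_split_at[OF assms, of "\<lambda>_. 1::nat" p] by simp

lemma sum_rDes_insert_max:
  assumes \<pi>: "\<pi> \<in> Sym n" and p: "p \<le> n" and r: "r \<ge> 1"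
  shows "sum f (rDes r (Suc n) (insert_max n \<pi> p)) =
    sum f {i \<in> rDes r n \<pi>. i < p} + (if p < n \<and> \<pi> (Suc p) + r \<le> Suc n then f (Suc p) else 0) +
    (\<Sum>i\<in>{i \<in> rDes r n \<pi>. p < i}. f (Suc i))"
proof -
  let ?M = "if p < n \<and> \<pi> (Suc p) + r \<le> Suc n then {Suc p} else {}"
  let ?Lo = "{i \<in> rDes r n \<pi>. i < p}" and ?Hi = "{i \<in> rDes r n \<pi>. p < i}"
  have "sum f (rDes r (Suc n) (insert_max n \<pi> p)) = sum f (?Lo \<union> ?M) + sum f (Suc ` ?Hi)"
    unfolding rDes_insert_max[OF assms] by (intro sum.union_disjoint) auto
  also have "sum f (?Lo \<union> ?M) = sum f ?Lo + sum f ?M"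
    by (intro sum.union_disjoint) auto
  finally show ?thesis
    by (simp add: sum.reindex)
qed

lemma quiet_slots_iff:
  assumes "\<pi> \<in> Sym n" "p \<le> n"
  shows "p \<in> quiet_slots r n \<pi> \<longleftrightarrow> \<not> (p < n \<and> \<pi> (Suc p) + r \<le> Suc n) \<or> p \<in> rDes r n \<pi>"
  using assms by (auto simp: quiet_slots_def)

text \<open>A descent at \<open>p\<close> forces a new one at \<open>Suc p\<close>, so the loss and
  the gain cancel.\<close>

lemma rdes_insert_max:
  assumes \<pi>: "\<pi> \<in> Sym n" and p: "p \<le> n" and r: "r \<ge> 1"
  shows "rdes r (Suc n) (insert_max n \<pi> p) =
    (if p \<in> quiet_slots r n \<pi> then rdes r n \<pi> else Suc (rdes r n \<pi>))"
proof -
  let ?small = "p < n \<and> \<pi> (Suc p) + r \<le> Suc n"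
  have "?small" if "p \<in> rDes r n \<pi>"
    using rDes_small[OF \<pi> that] by simp
  moreover have "card (rDes r (Suc n) (insert_max n \<pi> p)) + (if p \<in> rDes r n \<pi> then 1 else 0) =
      card (rDes r n \<pi>) + (if ?small then 1 else 0)"
    using sum_rDes_insert_max[OF assms, of "\<lambda>_. 1::nat"] card_split_at[of "rDes r n \<pi>" p]
    by simp
  ultimately show ?thesis
    unfolding rdes_def quiet_slots_iff[OF \<pi> p] by (cases "p \<in> rDes r n \<pi>"; cases ?small) simp_all
qed

text \<open>This is Rawlings' labelling: quiet slots are numbered from right to left starting with
  0, the others from left to right starting with \<open>card Q\<close>. At a quiet slot
  \<open>p < n\<close>, either a descent moves from \<open>p\<close> to \<open>Suc p\<close> or the
  next letter forms a new inversion; this one unit accounts for the slot \<open>n\<close>.\<close>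

lemma rmaj_insert_max:
  assumes \<pi>: "\<pi> \<in> Sym n" and p: "p \<le> n" and r: "r \<ge> 1"
  defines "Q \<equiv> quiet_slots r n \<pi>"
  shows "rmaj r (Suc n) (insert_max n \<pi> p) = rmaj r n \<pi> +
    (if p \<in> Q then card {y \<in> Q. p < y} else card Q + card {y \<in> {0..n} - Q. y < p})"
proof -
  let ?D = "rDes r n \<pi>" and ?small = "p < n \<and> \<pi> (Suc p) + r \<le> Suc n"
  define Hi where "Hi = {i \<in> ?D. p < i}"
  define B where "B = {y \<in> {0..<n}. Suc n < \<pi> (Suc y) + r \<and> p < y}"
  have "{x \<in> {Suc p..n}. Suc n < \<pi> x + r} =
      Suc ` (B \<union> (if p < n \<and> \<not> ?small then {p} else {}))" (is "?U = Suc ` ?V")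
  proof (intro equalityI subsetI)
    fix x assume x: "x \<in> ?U"
    then obtain y where "x = Suc y" by (cases x) auto
    with x show "x \<in> Suc ` ?V"
      by (cases "y = p") (auto simp: B_def)
  qed (auto simp: B_def split: if_splits)
  moreover have "card (Suc ` ?V) = card ?V"
    by (intro card_image) simp
  moreover have "card ?V = card B + (if p < n \<and> \<not> ?small then 1 else 0)"
    by (simp add: B_def)
  ultimately have inv: "card (rInv r (Suc n) (insert_max n \<pi> p)) =
      card (rInv r n \<pi>) + (card B + (if p < n \<and> \<not> ?small then 1 else 0))"
    using card_rInv_insert_max[OF \<pi> p, of r] by simp
  have maj: "\<Sum> (rDes r (Suc n) (insert_max n \<pi> p)) + (if p \<in> ?D then p else 0) =
      \<Sum> ?D + (if ?small then Suc p else 0) + card Hi"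
  proof -
    have "\<Sum> ?D = \<Sum> {i \<in> ?D. i < p} + (if p \<in> ?D then p else 0) + \<Sum> Hi"
      unfolding Hi_def by (rule sum_split_at) simp
    moreover have "\<Sum> (rDes r (Suc n) (insert_max n \<pi> p)) =
        \<Sum> {i \<in> ?D. i < p} + (if ?small then Suc p else 0) + sum Suc Hi"
      unfolding Hi_def by (rule sum_rDes_insert_max[OF \<pi> p r])
    moreover have "sum Suc Hi = \<Sum> Hi + card Hi"
      by (rule sum_Suc)
    ultimately show ?thesis
      by (simp only: add_ac)
  qed
  have "{y \<in> Q. p < y} = (Hi \<union> B) \<union> (if p < n then {n} else {})"
    using p rDes_small(1)[OF \<pi>] by (auto simp: Q_def quiet_slots_def Hi_def B_def)
  moreover have "n \<notin> Hi \<union> B" "Hi \<inter> B = {}"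
    using rDes_small[OF \<pi>] by (fastforce simp: Hi_def B_def)+
  moreover have "finite Hi" "finite B"
    by (simp_all add: Hi_def B_def)
  ultimately have above: "card {y \<in> Q. p < y} = card Hi + card B + (if p < n then 1 else 0)"
    by (simp add: card_Un_disjoint)
  have "card ({y \<in> Q. y < p} \<union> {y \<in> {0..n} - Q. y < p}) =
      card {y \<in> Q. y < p} + card {y \<in> {0..n} - Q. y < p}"
    by (intro card_Un_disjoint) (auto simp: Q_def)
  moreover have "{y \<in> Q. y < p} \<union> {y \<in> {0..n} - Q. y < p} = {..<p}"
    using p by auto
  \<comment> \<open>Splitting the slots left of \<open>p\<close> turns the position of a new descent
    into a count of slots.\<close>
  ultimately have below: "p = card {y \<in> Q. y < p} + card {y \<in> {0..n} - Q. y < p}"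
    by simp
  have Q: "p \<in> Q \<longleftrightarrow> \<not> ?small \<or> p \<in> ?D"
    unfolding Q_def by (rule quiet_slots_iff[OF \<pi> p])
  have small: "?small" if "p \<in> ?D"
    using rDes_small[OF \<pi> that] by simp
  show ?thesis
  proof (cases "p \<in> Q")
    case True
    then show ?thesis
      unfolding rmaj_def inv above using maj Q small p
      by (cases "p \<in> ?D"; cases ?small; cases "p = n") simp_all
  next
    case False
    have "card Q = card {y \<in> Q. y < p} + card {y \<in> Q. p < y}"
      using card_split_at[of Q p] False by (simp add: Q_def)
    then show ?thesis
      unfolding rmaj_def inv using maj above below Q False by simp
  qed
qed

section \<open>Recurrence for the generating function of \<open>rdes\<close> and
  \<open>rmaj\<close>\<close>

definition rmaj_poly :: "nat \<Rightarrow> 'a::comm_ring_1 \<Rightarrow> nat \<Rightarrow> 'a \<Rightarrow> 'a" where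
  "rmaj_poly r q n t = (\<Sum>\<pi>\<in>Sym n. t ^ rdes r n \<pi> * q ^ rmaj r n \<pi>)"

text \<open>The two summands collect the labels of the quiet slots and, with one more descent, of
  the other slots.\<close>

lemma rmaj_poly_Suc_sum:
  assumes r: "r \<ge> 1"
  shows "rmaj_poly r q (Suc n) t =
    (\<Sum>\<pi>\<in>Sym n. t ^ rdes r n \<pi> * q ^ rmaj r n \<pi> *
      (qnum q (card (quiet_slots r n \<pi>)) +
       t * q ^ card (quiet_slots r n \<pi>) * qnum q (Suc n - card (quiet_slots r n \<pi>))))"
proof -
  let ?w = "\<lambda>n \<pi>. t ^ rdes r n \<pi> * q ^ rmaj r n \<pi>"
  have "rmaj_poly r q (Suc n) t = (\<Sum>(\<pi>, p)\<in>Sym n \<times> {0..n}. ?w (Suc n) (insert_max n \<pi> p))"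
    unfolding rmaj_poly_def
    by (subst sum.reindex_bij_betw[OF bij_betw_insert_max, symmetric]) (simp add: case_prod_unfold)
  also have "\<dots> = (\<Sum>\<pi>\<in>Sym n. \<Sum>p\<in>{0..n}. ?w (Suc n) (insert_max n \<pi> p))"
    by (simp add: sum.cartesian_product)
  also have "\<dots> = (\<Sum>\<pi>\<in>Sym n. ?w n \<pi> * (qnum q (card (quiet_slots r n \<pi>)) +
       t * q ^ card (quiet_slots r n \<pi>) * qnum q (Suc n - card (quiet_slots r n \<pi>))))"
  proof (intro sum.cong refl)
    fix \<pi> assume \<pi>: "\<pi> \<in> Sym n"
    define Q where "Q = quiet_slots r n \<pi>"
    have Q: "Q \<subseteq> {0..n}" "finite Q"
      using quiet_slots_subset[OF \<pi>] by (auto simp: Q_def)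
    have "(\<Sum>p\<in>Q. ?w (Suc n) (insert_max n \<pi> p)) = (\<Sum>p\<in>Q. ?w n \<pi> * q ^ card {y \<in> Q. p < y})"
      using Q r \<pi> by (intro sum.cong refl)
        (auto simp: rdes_insert_max rmaj_insert_max Q_def[symmetric] power_add mult_ac subset_iff)
    moreover have "(\<Sum>p\<in>{0..n} - Q. ?w (Suc n) (insert_max n \<pi> p)) =
        (\<Sum>p\<in>{0..n} - Q. ?w n \<pi> * (t * q ^ card Q * q ^ card {y \<in> {0..n} - Q. y < p}))"
      using Q r \<pi> by (intro sum.cong refl)
        (auto simp: rdes_insert_max rmaj_insert_max Q_def[symmetric] power_add mult_ac)
    moreover have "card ({0..n} - Q) = Suc n - card Q"
      using Q by (simp add: card_Diff_subset)
    moreover have "(\<Sum>p\<in>{0..n}. ?w (Suc n) (insert_max n \<pi> p)) =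
        (\<Sum>p\<in>Q. ?w (Suc n) (insert_max n \<pi> p)) + (\<Sum>p\<in>{0..n} - Q. ?w (Suc n) (insert_max n \<pi> p))"
      using Q by (simp add: sum.subset_diff add.commute)
    ultimately show "(\<Sum>p\<in>{0..n}. ?w (Suc n) (insert_max n \<pi> p)) =
        ?w n \<pi> * (qnum q (card (quiet_slots r n \<pi>)) +
         t * q ^ card (quiet_slots r n \<pi>) * qnum q (Suc n - card (quiet_slots r n \<pi>)))"
      unfolding sum_distrib_left[symmetric] Q_def[symmetric]
      using sum_power_rank_rev[OF Q(2), of q] sum_power_rank[of "{0..n} - Q" q]
      by (simp only: finite_Diff finite_atLeastAtMost) (simp only: distrib_left)
  qed
  finally show ?thesis .
qed

lemma rmaj_poly_0: "rmaj_poly r q 0 t = 1"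
  by (simp add: rmaj_poly_def Sym_def rdes_def rmaj_def rDes_def rInv_def)

lemma rmaj_poly_Suc_small:
  assumes "r \<ge> 1" "Suc n \<le> r"
  shows "rmaj_poly r q (Suc n) t = qnum q (Suc n) * rmaj_poly r q n t"
proof -
  have "rmaj_poly r q (Suc n) t =
      (\<Sum>\<pi>\<in>Sym n. qnum q (Suc n) * (t ^ rdes r n \<pi> * q ^ rmaj r n \<pi>))"
    unfolding rmaj_poly_Suc_sum[OF assms(1)]
    using assms by (intro sum.cong refl) (simp add: card_quiet_slots mult.commute)
  then show ?thesis
    by (simp add: rmaj_poly_def sum_distrib_left)
qed

text \<open>The number of quiet slots is now \<open>rdes r n \<pi> + r\<close>, so after
  multiplication by \<open>1 - q\<close> the dependence on \<open>\<pi>\<close> is only through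
  \<open>q ^ rdes r n \<pi>\<close>.\<close>

lemma rmaj_poly_Suc_large:
  assumes r: "r \<ge> 1" "r \<le> n"
  shows "(1 - q) * rmaj_poly r q (Suc n) t =
    (1 - t * q ^ Suc n) * rmaj_poly r q n t - q ^ r * (1 - t) * rmaj_poly r q n (q * t)"
proof -
  have "(1 - q) * (x * (qnum q c + t * q ^ c * qnum q (Suc n - c))) =
      x * ((1 - q ^ c) + t * (q ^ c - q ^ Suc n))" if "c \<le> Suc n" for x c
  proof -
    have "(1 - q) * (x * (qnum q c + t * q ^ c * qnum q (Suc n - c))) =
        x * ((1 - q) * qnum q c + t * q ^ c * ((1 - q) * qnum q (Suc n - c)))"
      by (simp add: algebra_simps)
    also have "\<dots> = x * ((1 - q ^ c) + t * (q ^ c - q ^ c * q ^ (Suc n - c)))"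
      unfolding one_minus_times_qnum by (simp add: algebra_simps)
    also have "q ^ c * q ^ (Suc n - c) = q ^ Suc n"
      using that by (metis le_add_diff_inverse power_add)
    finally show ?thesis .
  qed
  note step = this
  have card: "card (quiet_slots r n \<pi>) = rdes r n \<pi> + r" "rdes r n \<pi> + r \<le> Suc n" if "\<pi> \<in> Sym n" for \<pi>
  proof -
    show c: "card (quiet_slots r n \<pi>) = rdes r n \<pi> + r"
      using card_quiet_slots[OF that, of r] r by simp
    show "rdes r n \<pi> + r \<le> Suc n"
      using card_mono[OF _ quiet_slots_subset[OF that, of r]] c by simp
  qed
  have "(1 - q) * rmaj_poly r q (Suc n) t =
    (\<Sum>\<pi>\<in>Sym n. t ^ rdes r n \<pi> * q ^ rmaj r n \<pi> *
      ((1 - q ^ (rdes r n \<pi> + r)) + t * (q ^ (rdes r n \<pi> + r) - q ^ Suc n)))"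
    unfolding rmaj_poly_Suc_sum[OF r(1)] sum_distrib_left
    by (intro sum.cong refl) (simp only: card step)
  \<comment> \<open>The factor \<open>q ^ rdes r n \<pi>\<close> is absorbed by replacing
    \<open>t\<close> with \<open>q * t\<close>.\<close>
  also have "\<dots> = (\<Sum>\<pi>\<in>Sym n. (1 - t * q ^ Suc n) * (t ^ rdes r n \<pi> * q ^ rmaj r n \<pi>) -
      q ^ r * (1 - t) * ((q * t) ^ rdes r n \<pi> * q ^ rmaj r n \<pi>))"
    by (intro sum.cong refl) (simp add: power_add algebra_simps)
  finally show ?thesis
    by (simp add: rmaj_poly_def sum_subtractf sum_distrib_left)
qed

subsection \<open>Denert's statistic as a sum over placements\<close>

lemma word_inv_subword:
  assumes "finite S"
  shows "word_inv (subword \<pi> S) = card {(x, y). x \<in> S \<and> y \<in> S \<and> x < y \<and> \<pi> y < \<pi> x}"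
proof -
  define xs where "xs = sorted_list_of_set S"
  have set: "set xs = S" and sorted: "sorted_wrt (<) xs"
    using assms by (simp_all add: xs_def)
  have less: "xs ! i < xs ! j \<longleftrightarrow> i < j" if "i < length xs" "j < length xs" for i j
    using sorted that by (metis sorted_wrt_nth_less less_asym linorder_less_linear)
  let ?I = "{(i, j). i < j \<and> j < length xs \<and> \<pi> (xs ! j) < \<pi> (xs ! i)}"
  let ?f = "\<lambda>(i, j). (xs ! i, xs ! j)"
  have "inj_on ?f ?I"
    using less by (intro inj_onI, clarsimp) (metis linorder_neqE_nat less_irrefl less_trans)
  moreover have "?f ` ?I = {(x, y). x \<in> S \<and> y \<in> S \<and> x < y \<and> \<pi> y < \<pi> x}"
  proof (intro equalityI subsetI)
    fix xy assume "xy \<in> {(x, y). x \<in> S \<and> y \<in> S \<and> x < y \<and> \<pi> y < \<pi> x}"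
    then obtain x y where xy: "xy = (x, y)" "x \<in> set xs" "y \<in> set xs" "x < y" "\<pi> y < \<pi> x"
      using set by auto
    then obtain i j where "x = xs ! i" "i < length xs" "y = xs ! j" "j < length xs"
      by (metis in_set_conv_nth)
    with xy less show "xy \<in> ?f ` ?I"
      by (intro image_eqI[of _ _ "(i, j)"]) auto
  qed (use set less in \<open>auto intro: nth_mem\<close>)
  ultimately have "card ?I = card {(x, y). x \<in> S \<and> y \<in> S \<and> x < y \<and> \<pi> y < \<pi> x}"
    using card_image by fastforce
  moreover have "word_inv (subword \<pi> S) = card ?I"
    unfolding word_inv_def subword_def xs_def[symmetric]
    by (rule arg_cong[where f = card]) auto
  ultimately show ?thesis
    by simp
qed

text \<open>The least letter that makes \<open>x\<close> a \<open>g\<close>-gap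
  \<open>l\<close>-level excedance place.\<close>

definition threshold :: "nat \<Rightarrow> nat \<Rightarrow> nat \<Rightarrow> nat" where
  "threshold g l x = max (x + g) l"

definition place_weight :: "nat \<Rightarrow> nat \<Rightarrow> 'a::comm_ring_1 \<Rightarrow> 'a \<Rightarrow> nat \<Rightarrow> 'a" where
  "place_weight g l q t x = (if l \<le> x then t else 1) * q ^ (x + g - 1)"

definition den_poly :: "nat \<Rightarrow> nat \<Rightarrow> 'a::comm_ring_1 \<Rightarrow> nat \<Rightarrow> 'a \<Rightarrow> 'a" where
  "den_poly g l q n t = (\<Sum>\<pi>\<in>Sym n. t ^ gexc g l n \<pi> * q ^ gden g l n \<pi>)"

lemma prod_place_weight:
  assumes "finite S"
  shows "(\<Prod>x\<in>S. place_weight g l q t x) = t ^ card {x \<in> S. l \<le> x} * q ^ (\<Sum>x\<in>S. x + g - 1)"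
  using assms
proof (induction S rule: finite_induct)
  case (insert x S)
  have "{y \<in> insert x S. l \<le> y} = (if l \<le> x then insert x {y \<in> S. l \<le> y} else {y \<in> S. l \<le> y})"
    by auto
  then show ?case
    using insert by (simp add: place_weight_def power_add mult_ac)
qed simp

text \<open>Permutations fix the places outside \<open>{1..n}\<close> and placements vanish there;
  the maps exchange these defaults. A placement without open places is injective on
  \<open>{1..n}\<close> with letters in \<open>{1..n}\<close>.\<close>

lemma bij_betw_Sym_placements:
  "bij_betw (\<lambda>\<pi> x. if x \<in> {1..n} then \<pi> x else 0) (Sym n) (placements n n 0)"
proof (rule bij_betw_byWitness[where f' = "\<lambda>p x. if x \<in> {1..n} then p x else x"])
  show "\<forall>\<pi>\<in>Sym n. (\<lambda>x. if x \<in> {1..n} then if x \<in> {1..n} then \<pi> x else 0 else x) = \<pi>"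
    by (auto simp: Sym_def permutes_def)
  show "\<forall>p\<in>placements n n 0. (\<lambda>x. if x \<in> {1..n} then if x \<in> {1..n} then p x else x else 0) = p"
    by (auto simp: placements_def)
  show "(\<lambda>\<pi> x. if x \<in> {1..n} then \<pi> x else 0) ` Sym n \<subseteq> placements n n 0"
  proof clarify
    fix \<pi> assume \<pi>: "\<pi> \<in> Sym n"
    have "open_places n (\<lambda>x. if x \<in> {1..n} then \<pi> x else 0) = {}"
      using Sym_range[OF \<pi>] by (fastforce simp: open_places_def)
    moreover have "inj_on (\<lambda>x. if x \<in> {1..n} then \<pi> x else 0)
        {x. (if x \<in> {1..n} then \<pi> x else 0) \<noteq> 0}"
      using Sym_inj[OF \<pi>] by (intro inj_onI) (simp add: inj_eq split: if_splits)
    moreover have "(if x \<in> {1..n} then \<pi> x else 0) \<le> n" for x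
      using Sym_range[OF \<pi>, of x] by simp
    ultimately show "(\<lambda>x. if x \<in> {1..n} then \<pi> x else 0) \<in> placements n n 0"
      by (simp add: placements_def)
  qed
  show "(\<lambda>p x. if x \<in> {1..n} then p x else x) ` placements n n 0 \<subseteq> Sym n"
  proof clarify
    fix p assume p: "p \<in> placements n n 0"
    have "open_places n p = {}"
      using placementsD(4)[OF p] by simp
    then have nz: "p x \<noteq> 0" if "x \<in> {1..n}" for x
      using that by (auto simp: open_places_def)
    let ?f = "\<lambda>x. if x \<in> {1..n} then p x else x"
    have "inj_on ?f {1..n}"
      using placementsD(3)[OF p] nz by (auto simp: inj_on_def)
    moreover have "?f ` {1..n} \<subseteq> {1..n}"
      using placementsD(2)[OF p] nz by (auto simp: Suc_le_eq)
    ultimately have "bij_betw ?f {1..n} {1..n}"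
      unfolding bij_betw_def using endo_inj_surj[of "{1..n}" ?f] by blast
    then show "?f \<in> Sym n"
      unfolding Sym_def by (auto intro!: bij_imp_permutes)
  qed
qed

text \<open>In a complete placement the letter \<open>z\<close> of a pair in \<open>nexc_inv\<close>
  is \<open>\<pi> y\<close> for a non-excedance \<open>y\<close> to the right of \<open>x\<close>,
  so the pair stands for an inversion of the non-excedance word.\<close>

lemma placement_weight_Sym:
  assumes \<pi>: "\<pi> \<in> Sym n" and g: "g \<ge> 1"
  shows "placement_weight (threshold g l) (place_weight g l q t) q n (\<lambda>x. if x \<in> {1..n} then \<pi> x else 0) =
    t ^ gexc g l n \<pi> * q ^ gden g l n \<pi>"
proof -
  let ?p = "\<lambda>x. if x \<in> {1..n} then \<pi> x else 0"
  let ?E = "gExcp g l n \<pi>" and ?N = "gNexcp g l n \<pi>"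
  have range: "1 \<le> \<pi> x" "\<pi> x \<le> n" if "x \<in> {1..n}" for x
    using Sym_range[OF \<pi> that] by auto
  \<comment> \<open>An excedance at place \<open>n\<close> would need a letter at least
    \<open>n + g > n\<close>.\<close>
  have not_last: "x \<in> {1..n - 1}" if "x \<in> {1..n}" "x + g \<le> \<pi> x" for x
    using range[OF that(1)] that g by auto
  with range(1) have exc: "exc_places (threshold g l) n ?p = ?E"
    by (fastforce simp: exc_places_def gExcp_def threshold_def)
  have sub: "?E \<subseteq> {1..n}" "?N = {1..n} - ?E"
    by (auto simp: gExcp_def gNexcp_def)
  have fin: "finite ?E" "finite ?N"
    by (auto simp: gExcp_def gNexcp_def)
  \<comment> \<open>For \<open>l \<le> i\<close> the gap condition yields the level condition on the
    letter, so \<open>gexc\<close> counts the excedance places from \<open>l\<close> on.\<close>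
  have exc_t: "{x \<in> ?E. l \<le> x} = {i \<in> {1..n}. i + g \<le> \<pi> i \<and> l \<le> i}"
    using not_last by (auto simp: gExcp_def)
  have "\<forall>x\<in>?E. ?p x = \<pi> x \<and> 0 < \<pi> x"
  proof
    fix x assume "x \<in> ?E"
    then have "x \<in> {1..n}"
      using sub(1) by blast
    then show "?p x = \<pi> x \<and> 0 < \<pi> x"
      using range(1)[of x] by simp
  qed
  moreover have "exc_inv (threshold g l) n p = {(x, y). x \<in> ?E \<and> y \<in> ?E \<and> x < y \<and> \<pi> y < \<pi> x}"
    if "exc_places (threshold g l) n p = ?E" "\<forall>x\<in>?E. p x = \<pi> x \<and> 0 < \<pi> x" for p
    unfolding exc_inv_def that(1) using that(2) by force
  ultimately have "exc_inv (threshold g l) n ?p = {(x, y). x \<in> ?E \<and> y \<in> ?E \<and> x < y \<and> \<pi> y < \<pi> x}"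
    using exc by blast
  then have inv_E: "card (exc_inv (threshold g l) n ?p) = word_inv (gExc g l n \<pi>)"
    using fin by (simp add: gExc_def word_inv_subword)
  have "nexc_inv (threshold g l) n ?p =
      (\<lambda>(x, y). (x, \<pi> y)) ` {(x, y). x \<in> ?N \<and> y \<in> ?N \<and> x < y \<and> \<pi> y < \<pi> x}" (is "?L = ?f ` ?R")
  proof (intro equalityI subsetI)
    fix xz assume "xz \<in> ?L"
    then have "case xz of (x, z) \<Rightarrow> x \<in> ?N \<and> z \<in> {1..<?p x} \<and> z \<notin> ?p ` ({1..<x} \<union> ?E)"
      unfolding nexc_inv_def exc sub(2) mem_Collect_eq .
    then obtain x z where xz: "xz = (x, z)" "x \<in> ?N" "z \<in> {1..<?p x}"
        "z \<notin> ?p ` ({1..<x} \<union> ?E)"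
      by blast
    have x: "x \<in> {1..n}"
      using xz(2) sub(2) by auto
    then have z: "z \<in> {1..n}" "z < \<pi> x"
      using xz(3) range(2)[of x] by auto
    then have "z \<in> \<pi> ` {1..n}"
      using \<pi> permutes_image[of \<pi> "{1..n}"] by (simp add: Sym_def)
    then obtain y where y: "y \<in> {1..n}" "z = \<pi> y" by blast
    then have "?p y = z"
      by simp
    then have "y \<notin> {1..<x}" "y \<notin> ?E"
      using xz(4) by blast+
    then have "(x, y) \<in> ?R"
      using y z xz(2) sub(2) by (cases "x = y") auto
    then show "xz \<in> ?f ` ?R"
      using xz(1) y(2) by force
  next
    fix xz assume "xz \<in> ?f ` ?R"
    then obtain x y where xy: "xz = (x, \<pi> y)" "x \<in> ?N" "y \<in> ?N" "x < y" "\<pi> y < \<pi> x"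
      by auto
    have "x \<in> {1..n}" "y \<in> {1..n}"
      using xy sub(2) by auto
    moreover have "\<pi> y \<notin> ?p ` ({1..<x} \<union> ?E)"
    proof
      assume "\<pi> y \<in> ?p ` ({1..<x} \<union> ?E)"
      then obtain w where w: "w \<in> {1..<x} \<union> ?E" "\<pi> y = ?p w"
        by blast
      moreover have "w \<in> {1..n}"
        using w(1) \<open>x \<in> {1..n}\<close> sub(1) by auto
      ultimately have "w = y"
        using Sym_inj[OF \<pi>] by (auto dest: injD)
      then show False
        using w(1) xy(3,4) sub(2) by auto
    qed
    moreover have "\<pi> y \<in> {1..<?p x}"
      using xy(5) range(1)[of y] \<open>x \<in> {1..n}\<close> \<open>y \<in> {1..n}\<close> by simp
    ultimately show "xz \<in> ?L"
      using xy(2) unfolding nexc_inv_def exc sub(2) mem_Collect_eq xy(1) prod.case by blast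
  qed
  moreover have "card (?f ` ?R) = card ?R"
    using Sym_inj[OF \<pi>] by (intro card_image) (auto simp: inj_on_def)
  ultimately have inv_N: "card (nexc_inv (threshold g l) n ?p) = word_inv (gNexc g l n \<pi>)"
    using fin by (simp add: gNexc_def word_inv_subword)
  show ?thesis
    unfolding placement_weight_def exc inv_E inv_N gden_def gexc_def prod_place_weight[OF fin(1)] exc_t
    by (simp add: power_add mult_ac)
qed

lemma den_poly_eq_placement_sum:
  assumes "g \<ge> 1"
  shows "den_poly g l q n t = placement_sum (threshold g l) (place_weight g l q t) q n n 0"
  unfolding den_poly_def placement_sum_def
  by (subst sum.reindex_bij_betw[OF bij_betw_Sym_placements, symmetric])
    (simp only: placement_weight_Sym[OF _ assms] cong: sum.cong)

lemma placement_sum_cong: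
  assumes "\<And>x. x \<in> {1..i} \<Longrightarrow> u x = v x"
  shows "placement_sum h u q i m e = placement_sum h v q i m e"
proof -
  have "(\<Prod>x\<in>exc_places h i p. u x) = (\<Prod>x\<in>exc_places h i p. v x)" for p
    using assms by (intro prod.cong) (auto simp: exc_places_def)
  then show ?thesis
    by (simp add: placement_sum_def placement_weight_def)
qed

text \<open>Once all letters have arrived, the remaining places are non-excedances.\<close>
lemma placement_sum_exhausted:
  assumes h: "\<And>x. i < x \<Longrightarrow> n < h x" and "i + k \<le> n"
  shows "placement_sum h u q (i + k) n 0 = (\<Prod>a<k. qnum q (n - i - a)) * placement_sum h u q i n 0"
  using assms(2)
proof (induction k)
  case (Suc k)
  then show ?case
    using placement_sum_Suc_place[of n h "i + k" u q 0] h by (simp add: mult_ac)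
qed simp

section \<open>State vectors\<close>

text \<open>The vector just before place \<open>Suc j\<close> is scanned, when exactly the letters
  below \<open>threshold g l (Suc j)\<close> have arrived.\<close>

definition state :: "nat \<Rightarrow> nat \<Rightarrow> 'a::comm_ring_1 \<Rightarrow> 'a \<Rightarrow> nat \<Rightarrow> nat \<Rightarrow> 'a" where
  "state g l q t j = placement_sum (threshold g l) (place_weight g l q t) q j (threshold g l (Suc j) - 1)"

text \<open>\<open>max g (l - Suc j)\<close> is the number of arrived letters minus the
  \<open>j\<close> earlier places.\<close>

lemma placement_sum_state:
  assumes "g \<ge> 1"
  shows "placement_sum (threshold g l) (place_weight g l q t) q (Suc j) (threshold g l (Suc j) - 1) =
    raising q (max g (l - Suc j)) (place_weight g l q t (Suc j)) (state g l q t j)"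
proof
  fix e
  have "threshold g l (Suc j) - 1 - j = max g (l - Suc j)" "j \<le> threshold g l (Suc j) - 1"
    "threshold g l (Suc j) - 1 < threshold g l (Suc j)"
    using assms by (auto simp: threshold_def)
  then show "placement_sum (threshold g l) (place_weight g l q t) q (Suc j) (threshold g l (Suc j) - 1) e =
    raising q (max g (l - Suc j)) (place_weight g l q t (Suc j)) (state g l q t j) e"
    by (simp add: placement_sum_Suc_place raising_def state_def)
qed

lemma state_0: "state g l q t 0 e = (if e = 0 then 1 else 0)"
  by (simp add: state_def placement_sum_0)

text \<open>Both thresholds equal \<open>l\<close>, so no letter arrives between the two
  places.\<close>

lemma state_Suc_plateau:
  assumes "g \<ge> 1" "Suc (Suc j) + g \<le> l"
  shows "state g l q t (Suc j) = raising q (l - Suc j) (place_weight g l q t (Suc j)) (state g l q t j)"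
proof -
  have "threshold g l (Suc (Suc j)) = threshold g l (Suc j)" "max g (l - Suc j) = l - Suc j"
    using assms by (auto simp: threshold_def)
  then show ?thesis
    using placement_sum_state[OF assms(1), of l q t j] by (simp add: state_def)
qed

text \<open>From here on the threshold grows by one per place, so one letter follows each place and
  the lead of the letters stays \<open>g\<close>.\<close>

lemma state_Suc:
  assumes "g \<ge> 1" "l \<le> Suc j + g"
  shows "state g l q t (Suc j) =
    lowering q (raising q g (place_weight g l q t (Suc j)) (state g l q t j))"
proof -
  have s: "max g (l - Suc j) = g"
    using assms by auto
  have "threshold g l (Suc (Suc j)) - 1 = Suc (threshold g l (Suc j) - 1)"
    using assms by (auto simp: threshold_def)
  moreover have "threshold g l y \<le> Suc (threshold g l (Suc j) - 1)" if "y \<in> {1..Suc j}" for y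
    using that by (auto simp: threshold_def)
  ultimately show ?thesis
    using placement_sum_state[OF assms(1), of l q t j]
    unfolding s state_def[of _ _ _ _ "Suc j"]
    by (intro ext) (simp only: placement_sum_Suc_letter lowering_def)
qed

text \<open>After \<open>n - g\<close> places all \<open>n\<close> letters have arrived; the last
  \<open>g\<close> places absorb the remaining letters in every order.\<close>

lemma den_poly_eq_state:
  assumes "g \<ge> 1" "g \<le> n" "l \<le> Suc n"
  shows "den_poly g l q n t = (\<Prod>a<g. qnum q (g - a)) * state g l q t (n - g) 0"
proof -
  have "threshold g l (Suc (n - g)) - 1 = n"
    using assms by (auto simp: threshold_def)
  moreover have "placement_sum (threshold g l) (place_weight g l q t) q (n - g + g) n 0 =
     (\<Prod>a<g. qnum q (n - (n - g) - a)) *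
     placement_sum (threshold g l) (place_weight g l q t) q (n - g) n 0"
    using assms by (intro placement_sum_exhausted) (auto simp: threshold_def)
  ultimately show ?thesis
    using assms by (simp add: den_poly_eq_placement_sum state_def)
qed

text \<open>Already the threshold of place 1 exceeds \<open>n\<close>, so there are no
  excedances.\<close>

lemma den_poly_short:
  assumes "g \<ge> 1" "n < max (Suc g) l"
  shows "den_poly g l q n t = (\<Prod>a<n. qnum q (n - a))"
proof -
  have "placement_sum (threshold g l) (place_weight g l q t) q (0 + n) n 0 =
     (\<Prod>a<n. qnum q (n - 0 - a)) * placement_sum (threshold g l) (place_weight g l q t) q 0 n 0"
    using assms by (intro placement_sum_exhausted) (auto simp: threshold_def)
  then show ?thesis
    using assms(1) by (simp add: den_poly_eq_placement_sum placement_sum_0)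
qed

text \<open>Initially only entry 0 is nonzero and \<open>q ^ e - q ^ j\<close> vanishes at
  \<open>e = j = 0\<close>. Then come the plateau steps, followed by the steps with a letter; no
  place before \<open>l\<close> carries a \<open>t\<close>.\<close>

lemma balanced_state:
  fixes q :: "'a::idom"
  assumes g: "g \<ge> 1" and q: "q \<noteq> 1"
  shows "Suc j \<le> l \<Longrightarrow> balanced q g (max g (l - Suc j)) j (state g l q t j)"
proof (induction j)
  case 0
  then show ?case
    by (simp add: balanced_def state_0)
next
  case (Suc j)
  then have IH: "balanced q g (max g (l - Suc j)) j (state g l q t j)"
    by simp
  have w: "place_weight g l q t (Suc j) = q ^ (j + g)"
    using Suc.prems by (simp add: place_weight_def)
  show ?case
  proof (cases "Suc (Suc j) + g \<le> l")
    case True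
    then have "max g (l - Suc j) = Suc (max g (l - Suc (Suc j)))" "l - Suc j = Suc (max g (l - Suc (Suc j)))"
      by auto
    then show ?thesis
      using balanced_raising[OF _ q] IH state_Suc_plateau[OF g True, of q t] by (simp add: w)
  next
    case False
    then have "max g (l - Suc j) = g" "max g (l - Suc (Suc j)) = g" "l \<le> Suc j + g"
      by auto
    then show ?thesis
      using balanced_lowering_raising[of q g j "state g l q t j"] IH state_Suc[OF g, of l j q t]
      by (simp add: w)
  qed
qed

section \<open>Recurrences for the generating function of Denert's statistic\<close>

text \<open>Short words give q-factorials. Otherwise the state is balanced, the middle term of
  \<open>balanced_iff\<close> vanishes at \<open>v = q ^ n\<close>, and entry 0 of
  \<open>intertwiner\<close> has the factor \<open>1 - q ^ Suc n\<close>.\<close>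

lemma den_poly_Suc_small:
  fixes q :: "'a::idom"
  assumes g: "g \<ge> 1" and q: "q \<noteq> 1" and n: "Suc n \<le> g + l - 1"
  shows "den_poly g l q (Suc n) t = qnum q (Suc n) * den_poly g l q n t"
proof (cases "Suc n < max (Suc g) l")
  case True
  then show ?thesis
    using g by (simp add: den_poly_short prod.lessThan_Suc_shift del: prod.lessThan_Suc)
next
  case False
  define j where "j = n - g"
  have j: "n = j + g" "Suc n - g = Suc j" "l \<le> Suc j + g" "Suc (Suc j) \<le> l"
    using False n by (auto simp: j_def)
  have w: "place_weight g l q t (Suc j) = q ^ n"
    using j by (simp add: place_weight_def)
  have "max g (l - Suc j) = g"
    using j by auto
  then have "balanced q g g j (state g l q t j)"
    using balanced_state[OF g q, of j l t] j by simp
  then have "(1 - q) * state g l q t (Suc j) 0 = intertwiner q (q ^ n) (state g l q t j) 0"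
    unfolding balanced_iff[of q g j _ "q ^ n"] using state_Suc[OF g j(3), of q t] by (simp add: w j(1))
  also have "\<dots> = (1 - q) * (qnum q (Suc n) * state g l q t j 0)"
    unfolding mult.assoc[symmetric] one_minus_times_qnum by (simp add: intertwiner_def mult.commute)
  finally have "state g l q t (Suc j) 0 = qnum q (Suc n) * state g l q t j 0"
    using q by simp
  moreover have "den_poly g l q n t = (\<Prod>a<g. qnum q (g - a)) * state g l q t j 0"
    "den_poly g l q (Suc n) t = (\<Prod>a<g. qnum q (g - a)) * state g l q t (Suc j) 0"
    using den_poly_eq_state[OF g, of n l q t] den_poly_eq_state[OF g, of "Suc n" l q t] j by simp_all
  ultimately show ?thesis
    by (simp add: mult_ac)
qed

text \<open>For \<open>k = 0\<close> this is \<open>balanced_iff\<close> at the first place carrying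
  \<open>t\<close>. The induction applies one more place and letter to the whole identity and moves
  it past \<open>intertwiner\<close>.\<close>

lemma state_recurrence:
  fixes q :: "'a::idom"
  assumes g: "g \<ge> 1" and l: "l \<ge> 1" and q: "q \<noteq> 1"
  shows "(1 - q) * state g l q t (l + k) e + q ^ (g + l - 1) * (1 - t) * state g l q (q * t) (l - 1 + k) e =
    intertwiner q (t * q ^ (g + l - 1 + k)) (state g l q t (l - 1 + k)) e"
proof (induction k arbitrary: e)
  case 0
  \<comment> \<open>The first \<open>l - 1\<close> places carry no \<open>t\<close>, so this state
    is unaffected by \<open>t\<close> becoming \<open>q * t\<close>.\<close>
  have "place_weight g l q (q * t) x = place_weight g l q t x" if "x \<in> {1..l - 1}" for x
    using that l by (auto simp: place_weight_def)
  then have t: "state g l q (q * t) (l - 1) = state g l q t (l - 1)"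
    unfolding state_def by (intro ext placement_sum_cong)
  have "balanced q g g (l - 1) (state g l q t (l - 1))"
    using balanced_state[OF g q, of "l - 1" l t] l by simp
  then have "(1 - q) * lowering q (raising q g (t * q ^ (g + l - 1)) (state g l q t (l - 1))) e +
      (q ^ (l - 1 + g) - t * q ^ (g + l - 1)) * state g l q t (l - 1) e =
      intertwiner q (t * q ^ (g + l - 1)) (state g l q t (l - 1)) e"
    unfolding balanced_iff[of q g "l - 1" _ "t * q ^ (g + l - 1)"] by blast
  moreover have "state g l q t l = lowering q (raising q g (t * q ^ (g + l - 1)) (state g l q t (l - 1)))"
    using state_Suc[OF g, of l "l - 1" q t] l by (simp add: place_weight_def add.commute)
  moreover have "l - 1 + g = g + l - 1"
    using l by simp
  ultimately show ?case
    unfolding add_0_right t by (simp add: algebra_simps)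
next
  case (Suc k)
  let ?v = "t * q ^ (g + l - 1 + k)"
  have idx: "l - 1 + Suc k = l + k" "l + k = Suc (l - 1 + k)"
    using l by auto
  \<comment> \<open>Under \<open>q * t\<close> the place \<open>l + k\<close> has the weight that
    the next place has under \<open>t\<close>, so one operator advances both states of the
    recurrence.\<close>
  have w: "place_weight g l q t (Suc (l + k)) = q * ?v" "place_weight g l q (q * t) (l + k) = q * ?v"
    "place_weight g l q t (l + k) = ?v"
  proof -
    have exponents: "Suc (l + k) + g - 1 = Suc (g + l - 1 + k)" "l + k + g - 1 = g + l - 1 + k"
      using g by auto
    show "place_weight g l q t (Suc (l + k)) = q * ?v" "place_weight g l q (q * t) (l + k) = q * ?v"
      "place_weight g l q t (l + k) = ?v"
      unfolding place_weight_def exponents by (simp_all add: mult_ac)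
  qed
  have s1: "state g l q t (Suc (l + k)) = lowering q (raising q g (q * ?v) (state g l q t (l + k)))"
    using state_Suc[OF g, of l "l + k" q t] by (simp add: w)
  have s2: "state g l q (q * t) (l + k) = lowering q (raising q g (q * ?v) (state g l q (q * t) (l - 1 + k)))"
    using state_Suc[OF g, of l "l - 1 + k" q "q * t"] l unfolding idx(2)[symmetric] w by simp
  have s3: "state g l q t (l + k) = lowering q (raising q g ?v (state g l q t (l - 1 + k)))"
    using state_Suc[OF g, of l "l - 1 + k" q t] l unfolding idx(2)[symmetric] w by simp
  have IH: "intertwiner q ?v (state g l q t (l - 1 + k)) =
      (\<lambda>e. (1 - q) * state g l q t (l + k) e +
        q ^ (g + l - 1) * (1 - t) * state g l q (q * t) (l - 1 + k) e)"
    using Suc.IH by auto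
  have "intertwiner q (q * ?v) (state g l q t (l + k)) =
      lowering q (raising q g (q * ?v) (intertwiner q ?v (state g l q t (l - 1 + k))))"
    unfolding s3 by (rule intertwining[symmetric])
  also have "\<dots> = (\<lambda>e. (1 - q) * state g l q t (Suc (l + k)) e +
        q ^ (g + l - 1) * (1 - t) * state g l q (q * t) (l + k) e)"
    unfolding IH lowering_raising_linear s1 s2 ..
  finally have step: "intertwiner q (q * ?v) (state g l q t (l + k)) e =
      (1 - q) * state g l q t (Suc (l + k)) e +
        q ^ (g + l - 1) * (1 - t) * state g l q (q * t) (l + k) e"
    by (rule fun_cong)
  have "t * q ^ (g + l - 1 + Suc k) = q * ?v" "l + Suc k = Suc (l + k)"
    by (simp_all add: mult_ac)
  then show ?case
    by (simp only: idx(1) step)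
qed

text \<open>This is entry 0 of \<open>state_recurrence\<close>, where \<open>intertwiner\<close>
  reduces to the factor \<open>1 - t * q ^ Suc n\<close>.\<close>

lemma den_poly_Suc_large:
  fixes q :: "'a::idom"
  assumes g: "g \<ge> 1" and l: "l \<ge> 1" and q: "q \<noteq> 1" and n: "g + l - 1 \<le> n"
  shows "(1 - q) * den_poly g l q (Suc n) t =
    (1 - t * q ^ Suc n) * den_poly g l q n t - q ^ (g + l - 1) * (1 - t) * den_poly g l q n (q * t)"
proof -
  define k where "k = n - (g + l - 1)"
  have k: "n - g = l - 1 + k" "Suc n - g = l + k" "g + l - 1 + k = n"
    using n g l by (auto simp: k_def)
  let ?C = "\<Prod>a<g. qnum q (g - a)"
  have "den_poly g l q n t = ?C * state g l q t (l - 1 + k) 0" for t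
    using den_poly_eq_state[OF g, of n l q t] n l by (simp add: k)
  note den = this
  have den_Suc: "den_poly g l q (Suc n) t = ?C * state g l q t (l + k) 0"
    using den_poly_eq_state[OF g, of "Suc n" l q t] n l by (simp add: k)
  have state: "(1 - q) * state g l q t (l + k) 0 =
      (1 - t * q ^ Suc n) * state g l q t (l - 1 + k) 0 -
      q ^ (g + l - 1) * (1 - t) * state g l q (q * t) (l - 1 + k) 0"
    using state_recurrence[OF g l q, of t k 0] unfolding k(3)
    by (simp add: intertwiner_def eq_diff_eq mult_ac)
  have "(1 - q) * den_poly g l q (Suc n) t = ?C * ((1 - q) * state g l q t (l + k) 0)"
    by (simp add: den_Suc mult.left_commute)
  then show ?thesis
    unfolding state den by (simp add: algebra_simps)
qed

section \<open>Comparison of the two recurrences\<close>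

text \<open>Both sides obey the same recurrence with the same initial value. The induction keeps
  \<open>t\<close> arbitrary because the recurrence also evaluates at \<open>q * t\<close>.\<close>

lemma den_poly_eq_rmaj_poly:
  fixes q :: "'a::idom"
  assumes g: "g \<ge> 1" and l: "l \<ge> 1" and q: "q \<noteq> 1"
  shows "den_poly g l q n t = rmaj_poly (g + l - 1) q n t"
proof (induction n arbitrary: t)
  case 0
  then show ?case
    using g by (simp add: den_poly_short rmaj_poly_0)
next
  case (Suc n)
  have r: "g + l - 1 \<ge> 1"
    using g l by simp
  show ?case
  proof (cases "Suc n \<le> g + l - 1")
    case True
    then show ?thesis
      by (simp only: den_poly_Suc_small[OF g q True] rmaj_poly_Suc_small[OF r True] Suc.IH)
  next
    case False
    then have n: "g + l - 1 \<le> n"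
      by simp
    have "(1 - q) * den_poly g l q (Suc n) t = (1 - q) * rmaj_poly (g + l - 1) q (Suc n) t"
      by (simp only: den_poly_Suc_large[OF g l q n] rmaj_poly_Suc_large[OF r n] Suc.IH)
    then show ?thesis
      using q by simp
  qed
qed

theorem mainTheorem1:
  fixes g l :: nat
  assumes "g \<ge> 1" and "l \<ge> 1"
  shows "r_Euler_Mahonian (g + l - 1) (gexc g l) (gden g l)"
proof -
  \<comment> \<open>This permits cancelling \<open>1 - var_q\<close> in the integral domain of
    polynomials.\<close>
  have "var_q \<noteq> 1"
    by (simp add: var_q_def one_pCons)
  then show ?thesis
    using den_poly_eq_rmaj_poly[OF assms, of var_q _ var_t]
    by (simp add: r_Euler_Mahonian_def den_poly_def rmaj_poly_def)
qed

end
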